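(* There exists a constant $M_9>0$, independent of $(h,\tau)$, such that $$\max_{0\le n\le T_\tau}\mathrm{dist}(\Gamma^n,\Gamma(t_n))\le M_9h^\alpha$$ for all sufficiently small $(h,\tau)$ satisfying the scale condition and CFL-condition of the context, where $\Gamma(t)$ is the level set $\{f(t,\cdot)=1\}$ of the smooth solution and $\Gamma^n$ is the discrete level set of the explicit scheme (both defined in the context).
   Context: Setting. $T>0$; $\Omega\subset\mathbb{R}^3$ is a bounded connected open set; $v\in C^4([0,T]\times\bar\Omega;\mathbb{R}^3)$ with $\nabla\cdot v=0$ and $\mathrm{supp}(v)\subset[0,T]\times\Omega$; $f^0\in C^4(\bar\Omega;\mathbb{R})$ with $f^0\equiv0$ in a neighborhood of $\partial\Omega$. $v$ and $f^0$ are extended by $0$ to $x\in\mathbb{R}^3\setminus\Omega$ (the extensions are $C^4$ and denoted by the same symbols). Moreover there is a connected open set $\Omega^+$ with $\overline{\Omega^+}\subset\Omega$, $f^0>1$ in $\Omega^+$, $f^0<1$ in $\Omega\setminus\overline{\Omega^+}$, and $\nabla f^0\neq0$ on $\partial\Omega^+$. Let $f$ be the $C^4$-solution of $\partial_tf+v\cdot\nabla f=0$ on $[0,T]\times\mathbb{R}^3$, $f(0,\cdot)=f^0$ (given by the method of characteristics), and $\Gamma(t)=\{x\in\Omega:f(t,x)=1\}$. Grid. $h,\tau>0$ are the space and time mesh sizes; $t_n=n\tau$; $T_\tau\in\mathbb{N}$ is such that $T\in[\tau T_\tau,\tau T_\tau+\tau)$. $e^1,e^2,e^3$ is the standard basis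 of $\mathbb{R}^3$; $B=\{\pm e^1,\pm e^2,\pm e^3,0\}$; $C_h(x)=\prod_{i=1}^3[x_i-\frac h2,x_i+\frac h2)$; $\Omega_h=\{x\in\Omega\cap h\mathbb{Z}^3:C_{2h}(x)\subset\Omega\}$; the boundary of $A\subset h\mathbb{Z}^3$ is $\partial A=\{x\in A:\{x\pm he^i:i=1,2,3\}\not\subset A\}$; $D_i\phi(x)=\frac{\phi(x+he^i)-\phi(x-he^i)}{2h}$. Scale condition: $0<\alpha\le1$ is fixed and $\tau$ is of order $h^{2-\alpha}$, i.e. $c\,h^{2-\alpha}\le\tau\le C\,h^{2-\alpha}$ with fixed constants $0<c\le C$. Explicit scheme. $g^0(x)=\frac1{h^3}\int_{C_h(x)}f^0(y)\,dy$, $u^n_i(x)=\frac1{\tau h^3}\int_{\tau n}^{\tau(n+1)}\int_{C_h(x)}v_i(s,y)\,dy\,ds$ for $x\in h\mathbb{Z}^3$, and for $0\le n\le T_\tau-1$, $x\in h\mathbb{Z}^3$, $$\Big(g^{n+1}(x)-\frac17\sum_{\omega\in B}g^n(x+h\omega)\Big)\frac1\tau+\sum_{j=1}^3u^n_j(x)D_jg^n(x)=0 .$$ CFL-condition: $\frac17\pm\frac\tau{2h}u^n_j(x)\ge0$ for all $n,j,x$. Discrete level set. $\Omega^n_+=\{x\in\Omega_h:g^n(x)>1\}$, $\bar\Omega^n_+=\{x+h\omega:x\in\Omega^n_+,\ \omega\in B\}$, $\Gamma^n=\partial\bar\Omega^n_+$ (boundary in the discrete sense above). Distance (one-sided). For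 $A,A'\subset\mathbb{R}^3$: $\mathrm{dist}(A,A')=\sup_{y\in A}\inf_{x\in A'}|y-x|$. *)

theory Defs
  imports "HOL-Analysis.Analysis"
begin

text \<open>
  \<open>C_closure k U f\<close> renders \<open>f \<in> C\<^sup>k\<close> on the closure of an open set \<open>U\<close>: all partial derivatives
  of \<open>f\<close> up to order \<open>k\<close> exist on \<open>U\<close> and they (and \<open>f\<close>) extend continuously to \<open>closure U\<close>.
  The function \<open>g b\<close> is the extended partial derivative in direction \<open>b\<close>.
  For instance \<open>U = {0<..<T} \<times> \<Omega>\<close> gives the space \<open>C\<^sup>k\<close> on \<open>{0..T} \<times> closure \<Omega>\<close>.
\<close>

primrec C_closure ::
  "nat \<Rightarrow> 'a::euclidean_space set \<Rightarrow> ('a \<Rightarrow> 'b::real_normed_vector) \<Rightarrow> bool" where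
  "C_closure 0 U f \<longleftrightarrow> continuous_on (closure U) f"
| "C_closure (Suc k) U f \<longleftrightarrow> continuous_on (closure U) f \<and>
     (\<exists>g. \<forall>b\<in>Basis. C_closure k U (g b) \<and>
        (\<forall>x\<in>U. ((\<lambda>s. f (x + s *\<^sub>R b)) has_vector_derivative g b x) (at 0)))"

definition partial_deriv :: "3 \<Rightarrow> (real^3 \<Rightarrow> real) \<Rightarrow> real^3 \<Rightarrow> real" where
  "partial_deriv i w x = deriv (\<lambda>s. w (x + s *\<^sub>R axis i 1)) 0"

definition gradient :: "(real^3 \<Rightarrow> real) \<Rightarrow> real^3 \<Rightarrow> real^3" where
  "gradient w x = (\<chi> i. partial_deriv i w x)"

definition divergence :: "(real^3 \<Rightarrow> real^3) \<Rightarrow> real^3 \<Rightarrow> real" where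
  "divergence w x = (\<Sum>i\<in>UNIV. partial_deriv i (\<lambda>y. w y $ i) x)"

text \<open>At \<open>t = 0\<close> and \<open>t = T\<close> the time derivative is the one-sided one.\<close>

definition transport_solution ::
  "real \<Rightarrow> (real \<Rightarrow> real^3 \<Rightarrow> real^3) \<Rightarrow> (real^3 \<Rightarrow> real) \<Rightarrow> (real \<Rightarrow> real^3 \<Rightarrow> real) \<Rightarrow> bool" where
  "transport_solution T v f0 f \<longleftrightarrow>
     C_closure 4 ({0<..<T} \<times> UNIV) (\<lambda>(t, x). f t x) \<and>
     (\<forall>t\<in>{0..T}. \<forall>x. vector_derivative (\<lambda>s. f s x) (at t within {0..T})
                       + v t x \<bullet> gradient (f t) x = 0) \<and>
     (\<forall>x. f 0 x = f0 x)"

definition level_set :: "(real^3) set \<Rightarrow> (real \<Rightarrow> real^3 \<Rightarrow> real) \<Rightarrow> real \<Rightarrow> (real^3) set" where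
  "level_set \<Omega> f t = {x \<in> \<Omega>. f t x = 1}"

definition grid :: "real \<Rightarrow> (real^3) set" where
  "grid h = {x. \<forall>i. \<exists>k::int. x $ i = h * of_int k}"

definition stencil :: "(real^3) set" where
  "stencil = insert 0 (\<Union>i\<in>UNIV. {axis i 1, - axis i 1})"

definition cell :: "real \<Rightarrow> real^3 \<Rightarrow> (real^3) set" where
  "cell h x = {y. \<forall>i. x $ i - h / 2 \<le> y $ i \<and> y $ i < x $ i + h / 2}"

definition inner_grid :: "real \<Rightarrow> (real^3) set \<Rightarrow> (real^3) set" where
  "inner_grid h \<Omega> = {x \<in> \<Omega> \<inter> grid h. cell (2 * h) x \<subseteq> \<Omega>}"

definition discrete_boundary :: "real \<Rightarrow> (real^3) set \<Rightarrow> (real^3) set" where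
  "discrete_boundary h A =
     {x \<in> A. \<not> (\<Union>i\<in>UNIV. {x + h *\<^sub>R axis i 1, x - h *\<^sub>R axis i 1}) \<subseteq> A}"

definition central_diff :: "real \<Rightarrow> 3 \<Rightarrow> (real^3 \<Rightarrow> real) \<Rightarrow> real^3 \<Rightarrow> real" where
  "central_diff h i \<phi> x = (\<phi> (x + h *\<^sub>R axis i 1) - \<phi> (x - h *\<^sub>R axis i 1)) / (2 * h)"

definition averaged_velocity ::
  "real \<Rightarrow> real \<Rightarrow> (real \<Rightarrow> real^3 \<Rightarrow> real^3) \<Rightarrow> nat \<Rightarrow> 3 \<Rightarrow> real^3 \<Rightarrow> real" where
  "averaged_velocity h \<tau> v n i x =
     1 / (\<tau> * h ^ 3) *
       integral {\<tau> * real n..\<tau> * real (n + 1)} (\<lambda>s. integral (cell h x) (\<lambda>y. v s y $ i))"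

text \<open>\<open>N\<close> is the number of time steps; only the values of \<open>g n\<close> on the grid are constrained
  (and used).\<close>

definition explicit_scheme ::
  "real \<Rightarrow> real \<Rightarrow> nat \<Rightarrow> (real \<Rightarrow> real^3 \<Rightarrow> real^3) \<Rightarrow> (real^3 \<Rightarrow> real) \<Rightarrow>
     (nat \<Rightarrow> real^3 \<Rightarrow> real) \<Rightarrow> bool" where
  "explicit_scheme h \<tau> N v f0 g \<longleftrightarrow>
     (\<forall>x\<in>grid h. g 0 x = 1 / h ^ 3 * integral (cell h x) f0) \<and>
     (\<forall>n<N. \<forall>x\<in>grid h.
        (g (Suc n) x - 1 / 7 * (\<Sum>\<omega>\<in>stencil. g n (x + h *\<^sub>R \<omega>))) * (1 / \<tau>)
        + (\<Sum>j\<in>UNIV. averaged_velocity h \<tau> v n j x * central_diff h j (g n) x) = 0)"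

definition CFL_condition ::
  "real \<Rightarrow> real \<Rightarrow> nat \<Rightarrow> (real \<Rightarrow> real^3 \<Rightarrow> real^3) \<Rightarrow> bool" where
  "CFL_condition h \<tau> N v \<longleftrightarrow>
     (\<forall>n<N. \<forall>j. \<forall>x\<in>grid h.
        1 / 7 + \<tau> / (2 * h) * averaged_velocity h \<tau> v n j x \<ge> 0 \<and>
        1 / 7 - \<tau> / (2 * h) * averaged_velocity h \<tau> v n j x \<ge> 0)"

definition discrete_level_set ::
  "real \<Rightarrow> (real^3) set \<Rightarrow> (real^3 \<Rightarrow> real) \<Rightarrow> (real^3) set" where
  "discrete_level_set h \<Omega> \<phi> =
     discrete_boundary h {x + h *\<^sub>R \<omega> | x \<omega>. x \<in> inner_grid h \<Omega> \<and> \<phi> x > 1 \<and> \<omega> \<in> stencil}"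

text \<open>Values in \<open>[0, \<infinity>]\<close>: the distance from the empty set is \<open>0\<close>, and the distance from a
  nonempty set to the empty set is \<open>\<infinity>\<close>.\<close>

definition one_sided_dist :: "'a::metric_space set \<Rightarrow> 'a set \<Rightarrow> ennreal" where
  "one_sided_dist A A' = (SUP y\<in>A. INF x\<in>A'. ennreal (dist y x))"

end

theory Submission
  imports Defs
begin

text \<open>
  The CFL condition makes the scheme monotone, so the local truncation errors of order
  \<open>\<tau>\<^sup>2 + h\<^sup>2 + \<tau> h\<close> add up over \<open>T / \<tau>\<close> steps to a uniform error of order
  \<open>\<tau> + h\<^sup>2 / \<tau> + h\<close>, which is \<open>O(h powr \<alpha>)\<close> under the scale condition. Hence \<open>f\<close> differs from
  \<open>1\<close> by \<open>O(h powr \<alpha>)\<close> on the discrete level set. At time \<open>0\<close> the gradient does not vanish on the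
  level set, so every point with \<open>\<bar>f - 1\<bar> \<le> \<epsilon>\<close> lies within \<open>O(\<epsilon>)\<close> of it; as \<open>f\<close> is constant along
  characteristics, and these depend on their initial point in a Lipschitz way, the same holds at
  every later time. Euler polygons together with a compactness argument take the place of the flow,
  so that no existence theorem for ordinary differential equations is needed.
\<close>

section \<open>Functions with bounded partial derivatives on a slab\<close>

text \<open>Nondegeneracy of the gradient is given only at time 0, and no lower bound for
  \<open>gradient (f t)\<close> is established later. So the estimate of the distance by the
  deviation from level 1 is proved at time 0, by compactness, and it is this estimate, not the
  gradient bound, that is transported. The smoothness hypotheses give partial derivatives in an open
  set and continuous extensions to its closure. Times 0 and T are therefore reached by passing to
  the limit in inequalities. The slab is unbounded in space and \<Omega> need not be convex: uniform
  bounds come from vanishing off a compact set, and Lipschitz and Taylor estimates are made on the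
  whole slab. In the error, the term h^2/\<tau> stems from the averaging over the stencil, a
  diffusion of size h^2 per step that carries no factor \<tau>. The lower scale bound turns it into
  h^\<alpha>/c; the upper one gives \<tau> \<le> C h^(2-\<alpha>) \<le> C h^\<alpha> for h \<le> 1,
  because \<alpha> \<le> 1.\<close>

lemma has_vector_derivative_from_origin:
  assumes "((\<lambda>r. \<phi> (s + r)) has_vector_derivative D) (at 0)"
  shows "(\<phi> has_vector_derivative D) (at s)"
proof -
  have "((\<lambda>t. t - s) has_vector_derivative 1) (at s)"
    by (auto intro!: derivative_eq_intros)
  then show ?thesis
    using vector_diff_chain_at[where f = "\<lambda>t. t - s" and f' = 1 and x = s
        and g = "\<lambda>r. \<phi> (s + r)" and g' = D] assms
    by (simp add: o_def)
qed

text \<open>Since only partial derivatives are available, the way from p to q is made along one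
  coordinate after the other. All edges stay in the box spanned by p and q, so derivatives are
  required only there. With \<open>w = 0\<close> this is a Lipschitz estimate, with \<open>w\<close>
  the partial derivatives at p a Taylor estimate.\<close>

lemma coordinatewise_mean_value:
  fixes F :: "'a::euclidean_space \<Rightarrow> 'b::real_normed_vector"
  assumes deriv: "\<And>r b. (\<And>i. i \<in> Basis \<Longrightarrow> r \<bullet> i \<in> closed_segment (p \<bullet> i) (q \<bullet> i)) \<Longrightarrow> b \<in> Basis \<Longrightarrow>
      \<exists>D. ((\<lambda>s. F (r + s *\<^sub>R b)) has_vector_derivative D) (at 0) \<and> norm (D - w b) \<le> B"
  shows "norm (F q - F p - (\<Sum>b\<in>Basis. ((q - p) \<bullet> b) *\<^sub>R w b)) \<le> B * (\<Sum>b\<in>Basis. \<bar>(q - p) \<bullet> b\<bar>)"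
proof -
  define d where "d = q - p"
  define path where "path S = p + (\<Sum>b\<in>S. (d \<bullet> b) *\<^sub>R b)" for S
  have "norm (F (path S) - F p - (\<Sum>b\<in>S. (d \<bullet> b) *\<^sub>R w b)) \<le> B * (\<Sum>b\<in>S. \<bar>d \<bullet> b\<bar>)"
    if "S \<subseteq> Basis" for S
    using finite_subset[OF that finite_Basis] that
  proof (induction S rule: finite_subset_induct')
    case empty
    then show ?case by (simp add: path_def)
  next
    case (insert b S)
    define I where "I = closed_segment 0 (d \<bullet> b)"
    have inside: "(path S + s *\<^sub>R b) \<bullet> i \<in> closed_segment (p \<bullet> i) (q \<bullet> i)"
      if s: "s \<in> I" and i: "i \<in> Basis" for s i
    proof -
      have "(\<Sum>b\<in>S. (d \<bullet> b) * (b \<bullet> i)) = (\<Sum>b\<in>S. if b = i then d \<bullet> i else 0)"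
        using i insert by (intro sum.cong) (auto simp: inner_Basis)
      hence "(path S + s *\<^sub>R b) \<bullet> i = p \<bullet> i + (if i \<in> S then d \<bullet> i else 0) + (if i = b then s else 0)"
        using insert i by (auto simp: path_def inner_add_left inner_sum_left inner_Basis)
      then show ?thesis
        using s insert
        by (auto simp: I_def d_def closed_segment_eq_real_ivl inner_diff_left split: if_splits)
    qed
    have "\<forall>s\<in>I. \<exists>D. ((\<lambda>t. F (path S + s *\<^sub>R b + t *\<^sub>R b)) has_vector_derivative D) (at 0)
        \<and> norm (D - w b) \<le> B"
      using deriv[OF inside] insert by blast
    then obtain D where D: "\<And>s. s \<in> I \<Longrightarrow>
        ((\<lambda>t. F (path S + s *\<^sub>R b + t *\<^sub>R b)) has_vector_derivative D s) (at 0)"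
      and DB: "\<And>s. s \<in> I \<Longrightarrow> norm (D s - w b) \<le> B"
      by metis
    \<comment> \<open>Subtracting the linear part turns closeness of the derivative to
      \<open>w b\<close> into a small derivative, to which the one-variable mean value bound
      applies.\<close>
    define k where "k s = F (path S + s *\<^sub>R b) - s *\<^sub>R w b" for s
    have k: "(k has_vector_derivative (D s - w b)) (at s within I)" if "s \<in> I" for s
    proof -
      have "((\<lambda>t. F (path S + (s + t) *\<^sub>R b)) has_vector_derivative D s) (at 0)"
        using D[OF that] by (simp add: scaleR_add_left add.assoc)
      then have "((\<lambda>t. F (path S + t *\<^sub>R b)) has_vector_derivative D s) (at s)"
        by (rule has_vector_derivative_from_origin[where \<phi> = "\<lambda>t. F (path S + t *\<^sub>R b)"])
      then have "((\<lambda>t. F (path S + t *\<^sub>R b)) has_vector_derivative D s) (at s within I)"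
        by (simp add: has_vector_derivative_at_within)
      then show ?thesis
        unfolding k_def by (auto intro!: derivative_eq_intros)
    qed
    have "norm (k (d \<bullet> b) - k 0) \<le> B * norm (d \<bullet> b - 0)"
    proof (rule differentiable_bound)
      show "convex I" by (simp add: I_def)
      show "(k has_derivative (\<lambda>x. x *\<^sub>R (D s - w b))) (at s within I)" if "s \<in> I" for s
        using k[OF that] by (simp add: has_vector_derivative_def)
      show "onorm (\<lambda>x. x *\<^sub>R (D s - w b)) \<le> B" if "s \<in> I" for s
        using mult_right_mono[OF DB[OF that] abs_ge_zero]
        by (intro onorm_le) (simp add: mult.commute)
    qed (auto simp: I_def)
    moreover have "path (insert b S) = path S + (d \<bullet> b) *\<^sub>R b"
      using insert by (simp add: path_def)
    ultimately have "norm (F (path (insert b S)) - F (path S) - (d \<bullet> b) *\<^sub>R w b) \<le> B * \<bar>d \<bullet> b\<bar>"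
      by (simp add: k_def algebra_simps)
    then have "norm ((F (path (insert b S)) - F (path S) - (d \<bullet> b) *\<^sub>R w b)
        + (F (path S) - F p - (\<Sum>b\<in>S. (d \<bullet> b) *\<^sub>R w b))) \<le> B * \<bar>d \<bullet> b\<bar> + B * (\<Sum>b\<in>S. \<bar>d \<bullet> b\<bar>)"
      using insert by (intro norm_triangle_mono) auto
    then show ?case
      using insert by (simp add: algebra_simps)
  qed
  moreover have "path Basis = q"
    by (simp add: path_def d_def euclidean_representation)
  ultimately show ?thesis
    unfolding d_def by force
qed

lemma sum_abs_inner_Basis_le: "(\<Sum>b\<in>Basis. \<bar>x \<bullet> b\<bar>) \<le> real DIM('a) * norm (x::'a::euclidean_space)"
  using sum_bounded_above[of Basis "\<lambda>b. \<bar>x \<bullet> b\<bar>" "norm x"] by (simp add: Basis_le_norm)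

lemma slab_segment:
  fixes p q r :: "real \<times> 'a::euclidean_space"
  assumes "p \<in> {a<..<b} \<times> UNIV" "q \<in> {a<..<b} \<times> UNIV"
    and "\<And>i. i \<in> Basis \<Longrightarrow> r \<bullet> i \<in> closed_segment (p \<bullet> i) (q \<bullet> i)"
  shows "r \<in> {a<..<b} \<times> UNIV"
proof -
  have "(1, 0) \<in> (Basis :: (real \<times> 'a) set)" by (auto simp: Basis_prod_def)
  then have "r \<bullet> (1, 0) \<in> closed_segment (p \<bullet> (1, 0)) (q \<bullet> (1, 0))" using assms(3) by blast
  then have "fst r \<in> closed_segment (fst p) (fst q)" by (simp add: inner_prod_def)
  then show ?thesis
    using assms(1,2) by (cases r) (auto simp: closed_segment_eq_real_ivl split: if_splits)
qed

text \<open>The slab restricts only the time coordinate and so contains the box between any two of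
  its points. The resulting inequality is continuous in the pair of points and thereby extends to
  the times a and b, where no derivative is given.\<close>

lemma slab_lipschitz:
  fixes F :: "real \<times> 'a::euclidean_space \<Rightarrow> 'b::real_normed_vector"
  assumes cont: "continuous_on (closure ({a<..<b} \<times> UNIV)) F"
    and deriv: "\<And>p i. p \<in> {a<..<b} \<times> UNIV \<Longrightarrow> i \<in> Basis \<Longrightarrow>
      \<exists>D. ((\<lambda>s. F (p + s *\<^sub>R i)) has_vector_derivative D) (at 0) \<and> norm D \<le> M"
    and M: "0 \<le> M"
    and pq: "p \<in> closure ({a<..<b} \<times> UNIV)" "q \<in> closure ({a<..<b} \<times> UNIV)"
  shows "norm (F q - F p) \<le> M * DIM(real \<times> 'a) * norm (q - p)"
proof -
  let ?U = "{a<..<b} \<times> (UNIV :: 'a set)"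
  have *: "norm (F q - F p) - M * DIM(real \<times> 'a) * norm (q - p) \<le> 0" if "p \<in> ?U" "q \<in> ?U" for p q
  proof -
    have "norm (F q - F p - (\<Sum>b\<in>Basis. ((q - p) \<bullet> b) *\<^sub>R 0)) \<le> M * (\<Sum>b\<in>Basis. \<bar>(q - p) \<bullet> b\<bar>)"
      using deriv[OF slab_segment[OF that]] by (intro coordinatewise_mean_value) simp
    also have "\<dots> \<le> M * (DIM(real \<times> 'a) * norm (q - p))"
      by (intro mult_left_mono sum_abs_inner_Basis_le M)
    finally show ?thesis by (simp add: mult.assoc)
  qed
  let ?c = "\<lambda>z. norm (F (snd z) - F (fst z)) - M * DIM(real \<times> 'a) * norm (snd z - fst z)"
  have "?c (p, q) \<le> 0"
  proof (rule continuous_le_on_closure[where f = ?c and S = "?U \<times> ?U"])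
    show "continuous_on (closure (?U \<times> ?U)) ?c"
      unfolding closure_Times[of ?U ?U]
      by (intro continuous_intros continuous_on_compose2[OF cont]) auto
    show "(p, q) \<in> closure (?U \<times> ?U)"
      using pq unfolding closure_Times[of ?U ?U] by blast
  qed (use * in auto)
  then show ?thesis by simp
qed

text \<open>On the box between p and q the partial derivatives differ from those at p by at most K
  times its l1 length; the mean value estimate contributes that length a second time. The l1 norm is
  at most the dimension times the Euclidean norm. Limits again cover the closed slab.\<close>

lemma slab_taylor:
  fixes F :: "real \<times> 'a::euclidean_space \<Rightarrow> 'b::real_normed_vector"
  assumes cont: "continuous_on (closure ({a<..<b} \<times> UNIV)) F"
    and contG: "\<And>i. i \<in> Basis \<Longrightarrow> continuous_on (closure ({a<..<b} \<times> UNIV)) (G i)"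
    and deriv: "\<And>p i. p \<in> {a<..<b} \<times> UNIV \<Longrightarrow> i \<in> Basis \<Longrightarrow>
      ((\<lambda>s. F (p + s *\<^sub>R i)) has_vector_derivative G i p) (at 0)"
    and lip: "\<And>p q i. p \<in> {a<..<b} \<times> UNIV \<Longrightarrow> q \<in> {a<..<b} \<times> UNIV \<Longrightarrow> i \<in> Basis \<Longrightarrow>
      norm (G i q - G i p) \<le> K * norm (q - p)"
    and K: "0 \<le> K"
    and pq: "p \<in> closure ({a<..<b} \<times> UNIV)" "q \<in> closure ({a<..<b} \<times> UNIV)"
  shows "norm (F q - F p - (\<Sum>i\<in>Basis. ((q - p) \<bullet> i) *\<^sub>R G i p))
      \<le> K * (DIM(real \<times> 'a) * norm (q - p))\<^sup>2"
proof -
  let ?U = "{a<..<b} \<times> (UNIV :: 'a set)"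
  let ?n = "real DIM(real \<times> 'a)"
  have *: "norm (F q - F p - (\<Sum>i\<in>Basis. ((q - p) \<bullet> i) *\<^sub>R G i p)) - K * (?n * norm (q - p))\<^sup>2 \<le> 0"
    if pq: "p \<in> ?U" "q \<in> ?U" for p q
  proof -
    let ?l = "\<Sum>b\<in>Basis. \<bar>(q - p) \<bullet> b\<bar>"
    have "norm (F q - F p - (\<Sum>i\<in>Basis. ((q - p) \<bullet> i) *\<^sub>R G i p)) \<le> (K * ?l) * ?l"
    proof (rule coordinatewise_mean_value)
      fix r i :: "real \<times> 'a"
      assume r: "\<And>i. i \<in> Basis \<Longrightarrow> r \<bullet> i \<in> closed_segment (p \<bullet> i) (q \<bullet> i)" and i: "i \<in> Basis"
      have rU: "r \<in> ?U" using slab_segment[OF pq r] .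
      have "norm (G i r - G i p) \<le> K * norm (r - p)" using lip[OF pq(1) rU i] .
      also have "norm (r - p) \<le> (\<Sum>b\<in>Basis. \<bar>(r - p) \<bullet> b\<bar>)" by (rule norm_le_l1)
      also have "\<dots> \<le> ?l"
        using r by (intro sum_mono) (fastforce simp: closed_segment_eq_real_ivl inner_diff_left split: if_splits)
      finally have "norm (G i r - G i p) \<le> K * ?l" using K by (simp add: mult_left_mono)
      then show "\<exists>D. ((\<lambda>s. F (r + s *\<^sub>R i)) has_vector_derivative D) (at 0) \<and> norm (D - G i p) \<le> K * ?l"
        using deriv[OF rU i] by blast
    qed
    also have "(K * ?l) * ?l = K * ?l\<^sup>2" by (simp add: power2_eq_square)
    also have "\<dots> \<le> K * (?n * norm (q - p))\<^sup>2"
      using K by (intro mult_left_mono power_mono sum_abs_inner_Basis_le) (auto intro: sum_nonneg)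
    finally show ?thesis by simp
  qed
  let ?c = "\<lambda>z. norm (F (snd z) - F (fst z) - (\<Sum>i\<in>Basis. ((snd z - fst z) \<bullet> i) *\<^sub>R G i (fst z)))
      - K * (?n * norm (snd z - fst z))\<^sup>2"
  have "?c (p, q) \<le> 0"
  proof (rule continuous_le_on_closure[where f = ?c and S = "?U \<times> ?U"])
    show "continuous_on (closure (?U \<times> ?U)) ?c"
      unfolding closure_Times[of ?U ?U]
      by (intro continuous_intros continuous_on_compose2[OF cont] continuous_on_compose2[OF contG]) auto
    show "(p, q) \<in> closure (?U \<times> ?U)"
      using pq unfolding closure_Times[of ?U ?U] by blast
  qed (use * in auto)
  then show ?thesis by simp
qed

section \<open>Regularity of the velocity and of the solution\<close>

lemma compact_uniform_bound:
  fixes G :: "'i \<Rightarrow> 'a::topological_space \<Rightarrow> 'b::real_normed_vector"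
  assumes "finite I" "compact K" "\<And>i. i \<in> I \<Longrightarrow> continuous_on K (G i)"
  obtains M where "M \<ge> 0" "\<And>i p. i \<in> I \<Longrightarrow> p \<in> K \<Longrightarrow> norm (G i p) \<le> M"
proof -
  have "bounded (\<Union>i\<in>I. G i ` K)"
    using assms by (intro compact_imp_bounded compact_UN compact_continuous_image) auto
  then obtain M where "M > 0" "\<And>y. y \<in> (\<Union>i\<in>I. G i ` K) \<Longrightarrow> norm y \<le> M"
    by (auto simp: bounded_pos)
  then show thesis by (intro that[of M]) auto
qed

lemma C_closure_imp_continuous: "C_closure k U F \<Longrightarrow> continuous_on (closure U) F"
  by (cases k) auto

lemma slab_closure:
  "a < b \<Longrightarrow> closure ({a<..<b::real} \<times> (A :: 'a::metric_space set)) = {a..b} \<times> closure A"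
  by (simp add: closure_Times)

lemma norm_prod_le: "norm p \<le> \<bar>fst p\<bar> + norm (snd p)"
  for p :: "real \<times> 'a::real_normed_vector"
  using norm_Pair_le[of "fst p" "snd p"] by simp

text \<open>Bounded derivatives on \<Omega> alone would not give a Lipschitz bound, as \<Omega> need
  not be convex. The extension by 0 has bounded partial derivatives on the whole slab: inside
  \<Omega> by compactness of the closure, outside because it vanishes near each such point.\<close>

lemma velocity_lipschitz:
  fixes v :: "real \<Rightarrow> real^3 \<Rightarrow> real^3"
  assumes T: "0 < T" and \<Omega>: "bounded \<Omega>" and \<Omega>o: "open \<Omega>"
    and smooth: "C_closure (Suc k) ({0<..<T} \<times> \<Omega>) (\<lambda>(t, x). v t x)"
    and supp: "closure {(t, x). t \<in> {0..T} \<and> x \<in> closure \<Omega> \<and> v t x \<noteq> 0} \<subseteq> {0..T} \<times> \<Omega>"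
    and zero: "\<And>t x. t \<in> {0..T} \<Longrightarrow> x \<notin> \<Omega> \<Longrightarrow> v t x = 0"
  obtains L where "L \<ge> 0"
    "\<And>s t x y. s \<in> {0..T} \<Longrightarrow> t \<in> {0..T} \<Longrightarrow> norm (v t y - v s x) \<le> L * (\<bar>t - s\<bar> + norm (y - x))"
    "\<And>t x. t \<in> {0..T} \<Longrightarrow> norm (v t x) \<le> L"
proof -
  define F where "F = (\<lambda>(t, x). v t x)"
  define S where "S = closure {(t, x). t \<in> {0..T} \<and> x \<in> closure \<Omega> \<and> v t x \<noteq> 0}"
  let ?K = "{0..T} \<times> closure \<Omega>"
  have clo: "closure ({0<..<T} \<times> \<Omega>) = ?K" using T by (rule slab_closure)
  have K: "compact ?K" using \<Omega> by (intro compact_Times) auto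
  have FK: "continuous_on ?K F"
    using C_closure_imp_continuous[OF smooth] clo by (simp add: F_def)
  from smooth obtain g where gC: "\<forall>i\<in>Basis. C_closure k ({0<..<T} \<times> \<Omega>) (g i) \<and>
      (\<forall>p\<in>{0<..<T} \<times> \<Omega>. ((\<lambda>s. F (p + s *\<^sub>R i)) has_vector_derivative g i p) (at 0))"
    unfolding C_closure.simps F_def[symmetric] by blast
  then have g: "((\<lambda>s. F (p + s *\<^sub>R i)) has_vector_derivative g i p) (at 0)"
    if "i \<in> Basis" "p \<in> {0<..<T} \<times> \<Omega>" for i p
    using that by blast
  have gK: "continuous_on ?K (g i)" if "i \<in> Basis" for i
    using gC that C_closure_imp_continuous[of k "{0<..<T} \<times> \<Omega>" "g i"] unfolding clo by blast
  obtain M where M: "M \<ge> 0" "\<And>i p. i \<in> Basis \<Longrightarrow> p \<in> ?K \<Longrightarrow> norm (g i p) \<le> M"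
    by (rule compact_uniform_bound[OF finite_Basis K gK]) blast+
  obtain V where V: "V \<ge> 0" "\<And>p. p \<in> ?K \<Longrightarrow> norm (F p) \<le> V"
    by (rule compact_uniform_bound[of "{()}" ?K "\<lambda>_. F"]) (use K FK in auto)
  have slab: "closure ({0<..<T} \<times> UNIV) = {0..T} \<times> (UNIV :: (real^3) set)"
    using slab_closure[OF T, of UNIV] by simp
  have "closed S" by (simp add: S_def)
  have offS: "F p = 0" if "fst p \<in> {0..T}" "p \<notin> S" for p
  proof (cases "snd p \<in> \<Omega>")
    case True
    have "p \<notin> {(t, x). t \<in> {0..T} \<and> x \<in> closure \<Omega> \<and> v t x \<noteq> 0}"
      using that(2) unfolding S_def by (rule contra_subsetD[OF closure_subset])
    then show ?thesis using True that closure_subset[of \<Omega>] by (cases p) (auto simp: F_def)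
  next
    case False
    then show ?thesis using zero that by (cases p) (auto simp: F_def)
  qed
  \<comment> \<open>Two closed pieces, overlapping over the frontier of \<Omega>, where the velocity
    is 0, are glued to the closed slab.\<close>
  have "continuous_on (?K \<union> {0..T} \<times> - \<Omega>) F"
  proof (rule continuous_on_closed_Un)
    show "continuous_on ({0..T} \<times> - \<Omega>) F"
      using zero by (subst continuous_on_cong[OF refl, of _ _ "\<lambda>_. 0"]) (auto simp: F_def)
  qed (use FK \<Omega>o in \<open>auto intro: closed_Times\<close>)
  moreover have "?K \<union> {0..T} \<times> - \<Omega> = {0..T} \<times> UNIV"
    using closure_subset[of \<Omega>] by auto
  ultimately have F: "continuous_on ({0..T} \<times> UNIV) F" by simp
  have "\<exists>D. ((\<lambda>s. F (p + s *\<^sub>R i)) has_vector_derivative D) (at 0) \<and> norm D \<le> M"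
    if p: "p \<in> {0<..<T} \<times> UNIV" and i: "i \<in> Basis" for p i
  proof (cases "snd p \<in> \<Omega>")
    case True
    then have "p \<in> {0<..<T} \<times> \<Omega>" "p \<in> ?K"
      using p closure_subset[of \<Omega>] by (auto simp: mem_Times_iff)
    then show ?thesis using g[OF i] M(2)[OF i] by blast
  next
    case False
    define W where "W = (\<lambda>s. p + s *\<^sub>R i) -` ({0<..<T} \<times> UNIV - S)"
    have W: "open W"
      unfolding W_def
      by (intro open_vimage open_Diff open_Times \<open>closed S\<close>) (auto intro!: continuous_intros)
    \<comment> \<open>Here the support hypothesis enters: the closed support S lies over \<Omega>,
      so a point over the complement, frontier included, has a neighbourhood free of S.\<close>
    have W0: "0 \<in> W"
      using p False supp unfolding W_def S_def by (auto simp: mem_Times_iff)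
    have F0: "0 = F (p + s *\<^sub>R i)" if "s \<in> W" for s
      using that offS[of "p + s *\<^sub>R i"] by (auto simp: W_def mem_Times_iff)
    have "((\<lambda>s. F (p + s *\<^sub>R i)) has_vector_derivative 0) (at 0)"
      using F0 by (rule has_vector_derivative_transform_within_open[OF has_vector_derivative_const W W0])
    then show ?thesis using M(1) by auto
  qed
  note lip = slab_lipschitz[OF F[folded slab] this M(1), unfolded slab]
  define L where "L = M * real DIM(real \<times> (real^3)) + V"
  have L: "M * real DIM(real \<times> (real^3)) \<le> L" "V \<le> L" "0 \<le> L"
    using M(1) V(1) by (auto simp: L_def)
  show thesis
  proof
    fix s t x y assume st: "s \<in> {0..T}" "t \<in> {0..T}"
    have "norm (v t y - v s x) \<le> M * real DIM(real \<times> (real^3)) * norm ((t, y) - (s, x))"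
      using lip[of "(s, x)" "(t, y)"] st by (simp add: F_def)
    also have "\<dots> \<le> L * (\<bar>t - s\<bar> + norm (y - x))"
      using norm_prod_le[of "(t, y) - (s, x)"] L by (intro mult_mono) auto
    finally show "norm (v t y - v s x) \<le> L * (\<bar>t - s\<bar> + norm (y - x))" .
  next
    fix t x assume t: "t \<in> {0..T}"
    show "norm (v t x) \<le> L"
    proof (cases "x \<in> \<Omega>")
      case True
      then have "(t, x) \<in> ?K" using t closure_subset[of \<Omega>] by auto
      then show ?thesis using V(2)[of "(t, x)"] L by (auto simp: F_def)
    qed (use zero[OF t] L in auto)
  qed (fact L)
qed

text \<open>Passes vanishing on an open set from a function to its partial derivatives; it is
  applied twice, to reach the second derivatives of the solution.\<close>

lemma directional_derivative_on_zero_set: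
  fixes \<phi> :: "'a::real_normed_vector \<Rightarrow> 'b::real_normed_vector"
  assumes "open V" "p \<in> V" "\<And>q. q \<in> V \<Longrightarrow> \<phi> q = 0"
    and "((\<lambda>s. \<phi> (p + s *\<^sub>R i)) has_vector_derivative D) (at 0)"
  shows "D = 0"
proof -
  define W where "W = (\<lambda>s. p + s *\<^sub>R i) -` V"
  have W: "open W" unfolding W_def by (intro open_vimage \<open>open V\<close>) (auto intro!: continuous_intros)
  have W0: "0 \<in> W" using assms(2) by (simp add: W_def)
  have "0 = \<phi> (p + s *\<^sub>R i)" if "s \<in> W" for s using assms(3) that by (simp add: W_def)
  then have "((\<lambda>s. \<phi> (p + s *\<^sub>R i)) has_vector_derivative 0) (at 0)"
    by (rule has_vector_derivative_transform_within_open[OF has_vector_derivative_const W W0])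
  with assms(4) show ?thesis by (rule vector_derivative_unique_at)
qed


text \<open>Recovers derivatives from the uniform Taylor estimate. Being stated within S, it also
  covers the one-sided time derivatives at 0 and T and the spatial derivatives at these
  times.\<close>

lemma has_real_derivative_of_quadratic_error:
  fixes \<phi> :: "real \<Rightarrow> real"
  assumes "\<And>t. t \<in> S \<Longrightarrow> \<bar>\<phi> t - \<phi> a - (t - a) * D\<bar> \<le> L * \<bar>t - a\<bar>\<^sup>2"
  shows "(\<phi> has_real_derivative D) (at a within S)"
proof -
  have "((\<lambda>t. (\<phi> t - \<phi> a) / (t - a) - D) \<longlongrightarrow> 0) (at a within S)"
  proof (rule Lim_null_comparison)
    show "\<forall>\<^sub>F t in at a within S. norm ((\<phi> t - \<phi> a) / (t - a) - D) \<le> L * \<bar>t - a\<bar>"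
      unfolding eventually_at_filter
    proof (intro always_eventually allI impI)
      fix t assume t: "t \<noteq> a" "t \<in> S"
      have "(\<phi> t - \<phi> a) / (t - a) - D = (\<phi> t - \<phi> a - (t - a) * D) / (t - a)"
        using t by (simp add: field_simps)
      then show "norm ((\<phi> t - \<phi> a) / (t - a) - D) \<le> L * \<bar>t - a\<bar>"
        using assms[OF t(2)] t by (simp add: abs_divide field_simps power2_eq_square)
    qed
    show "((\<lambda>t. L * \<bar>t - a\<bar>) \<longlongrightarrow> 0) (at a within S)"
      by (auto intro!: tendsto_eq_intros)
  qed
  then show ?thesis
    unfolding has_field_derivative_iff using Lim_null by blast
qed

lemma sum_Basis_time_space:
  fixes \<phi> :: "real \<times> (real^3) \<Rightarrow> 'c::comm_monoid_add"
  shows "(\<Sum>i\<in>Basis. \<phi> i) = \<phi> (1, 0) + (\<Sum>k\<in>UNIV. \<phi> (0, axis k 1))"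
proof -
  have "(Basis :: (real^3) set) = range (\<lambda>k. axis k 1)"
    by (auto simp: Basis_vec_def)
  then have B: "(Basis :: (real \<times> (real^3)) set) = insert (1, 0) (range (\<lambda>k. (0, axis k 1)))"
    by (auto simp: Basis_prod_def)
  have "inj (\<lambda>k::3. (0::real, axis k (1::real)))" by (auto simp: inj_on_def axis_eq_axis)
  then show ?thesis unfolding B by (subst sum.insert) (auto simp: sum.reindex)
qed

text \<open>At a point where the velocity vanishes at all times, the equation leaves a zero time
  derivative, so the solution is constant in time there. The end times form the exceptional set
  \<open>{0, T}\<close>, at which continuity suffices.\<close>

lemma transport_solution_outside:
  assumes T: "0 < T"
    and sol: "transport_solution T v f0 f"
    and v0: "\<And>t. t \<in> {0..T} \<Longrightarrow> v t x = 0"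
    and t: "t \<in> {0..T}"
  shows "f t x = f0 x"
proof -
  define F where "F = (\<lambda>(t, x). f t x)"
  have C: "C_closure (Suc 3) ({0<..<T} \<times> UNIV) F"
    using sol unfolding transport_solution_def F_def by simp
  then obtain g where "\<forall>i\<in>Basis. C_closure 3 ({0<..<T} \<times> UNIV) (g i) \<and>
      (\<forall>p\<in>{0<..<T} \<times> UNIV. ((\<lambda>s. F (p + s *\<^sub>R i)) has_vector_derivative g i p) (at 0))"
    unfolding C_closure.simps by blast
  moreover have "(1, 0) \<in> (Basis :: (real \<times> (real^3)) set)" by (simp add: Basis_prod_def)
  ultimately have g: "((\<lambda>s. F ((r, x) + s *\<^sub>R (1, 0))) has_vector_derivative g (1, 0) (r, x)) (at 0)"
    if "r \<in> {0<..<T}" for r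
    using that by blast
  have F: "continuous_on ({0..T} \<times> UNIV) F"
    using C_closure_imp_continuous[OF C] slab_closure[OF T, of "UNIV :: (real^3) set"] by simp
  show ?thesis
  proof (rule has_derivative_zero_unique_strong_interval[where f = "\<lambda>s. f s x" and k = "{0, T}" and a = 0 and b = T])
    show "continuous_on {0..T} (\<lambda>s. f s x)"
    proof -
      have "continuous_on {0..T} (\<lambda>s. F (s, x))"
        by (rule continuous_on_compose2[OF F]) (auto intro!: continuous_intros)
      then show ?thesis by (simp add: F_def)
    qed
    show "f 0 x = f0 x" using sol by (simp add: transport_solution_def)
    fix r assume r: "r \<in> {0..T} - {0, T}"
    then have "((\<lambda>s. f s x) has_vector_derivative g (1, 0) (r, x)) (at r)"
      using has_vector_derivative_from_origin[where \<phi> = "\<lambda>s. f s x"] g[of r] by (auto simp: F_def)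
    moreover from this have "g (1, 0) (r, x) = vector_derivative (\<lambda>s. f s x) (at r within {0..T})"
      using r T vector_derivative_at_within_ivl by force
    moreover have "vector_derivative (\<lambda>s. f s x) (at r within {0..T}) = 0"
    proof -
      have "vector_derivative (\<lambda>s. f s x) (at r within {0..T}) + v r x \<bullet> gradient (f r) x = 0"
        using sol r unfolding transport_solution_def by blast
      then show ?thesis using v0 r by simp
    qed
    ultimately show "((\<lambda>s. f s x) has_derivative (\<lambda>h. 0)) (at r within {0..T})"
      by (simp add: has_vector_derivative_def has_derivative_at_withinI)
  qed (use t in auto)
qed

text \<open>The solution vanishes off \<Omega>, hence its first and second partial derivatives
  vanish off the closure of \<Omega>, and over that closure they are bounded by compactness. The
  Taylor remainder is then uniform on the unbounded slab.\<close>

lemma transport_solution_regularity: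
  fixes v :: "real \<Rightarrow> real^3 \<Rightarrow> real^3"
  assumes T: "0 < T" and \<Omega>: "bounded \<Omega>"
    and sol: "transport_solution T v f0 f"
    and v0: "\<And>t x. t \<in> {0..T} \<Longrightarrow> x \<notin> \<Omega> \<Longrightarrow> v t x = 0"
    and f00: "\<And>x. x \<notin> \<Omega> \<Longrightarrow> f0 x = 0"
  obtains ft L where "L \<ge> 0"
    "\<And>s t x y. s \<in> {0..T} \<Longrightarrow> t \<in> {0..T} \<Longrightarrow>
      \<bar>f t y - f s x - (t - s) * ft s x - gradient (f s) x \<bullet> (y - x)\<bar> \<le> L * (\<bar>t - s\<bar> + norm (y - x))\<^sup>2"
    "\<And>s x. s \<in> {0..T} \<Longrightarrow> ft s x + v s x \<bullet> gradient (f s) x = 0"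
    "\<And>t x y. t \<in> {0..T} \<Longrightarrow> \<bar>f t y - f t x\<bar> \<le> L * norm (y - x)"
    "\<And>t x. t \<in> {0..T} \<Longrightarrow> x \<notin> \<Omega> \<Longrightarrow> f t x = 0"
    "\<And>t. t \<in> {0..T} \<Longrightarrow> continuous_on UNIV (gradient (f t))"
proof -
  define F where "F = (\<lambda>(t, x). f t x)"
  let ?U = "{0<..<T} \<times> (UNIV :: (real^3) set)"
  let ?K = "{0..T} \<times> closure \<Omega>"
  have clo: "closure ?U = {0..T} \<times> UNIV" using slab_closure[OF T, of UNIV] by simp
  have K: "compact ?K" using \<Omega> by (intro compact_Times) auto
  have outside: "f t x = 0" if "t \<in> {0..T}" "x \<notin> \<Omega>" for t x
    using transport_solution_outside[OF T sol] v0 f00 that by metis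

  have C: "C_closure (Suc 3) ?U F"
    using sol unfolding transport_solution_def F_def by simp
  then obtain g where gC: "\<forall>i\<in>Basis. C_closure 3 ?U (g i) \<and>
      (\<forall>p\<in>?U. ((\<lambda>s. F (p + s *\<^sub>R i)) has_vector_derivative g i p) (at 0))"
    unfolding C_closure.simps by blast
  then have gC': "\<forall>i\<in>Basis. C_closure (Suc 2) ?U (g i)" by (simp add: numeral_3_eq_3 numeral_2_eq_2)
  have "\<forall>i\<in>Basis. \<exists>h. \<forall>j\<in>Basis. C_closure 2 ?U (h j) \<and>
      (\<forall>p\<in>?U. ((\<lambda>s. g i (p + s *\<^sub>R j)) has_vector_derivative h j p) (at 0))"
    using gC' unfolding C_closure.simps by blast
  then obtain h where hC: "\<forall>i\<in>Basis. \<forall>j\<in>Basis. C_closure 2 ?U (h i j) \<and>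
      (\<forall>p\<in>?U. ((\<lambda>s. g i (p + s *\<^sub>R j)) has_vector_derivative h i j p) (at 0))"
    unfolding bchoice_iff by blast
  have g: "((\<lambda>s. F (p + s *\<^sub>R i)) has_vector_derivative g i p) (at 0)"
    if "i \<in> Basis" "p \<in> ?U" for i p
    using gC that by blast
  have h: "((\<lambda>s. g i (p + s *\<^sub>R j)) has_vector_derivative h i j p) (at 0)"
    if "i \<in> Basis" "j \<in> Basis" "p \<in> ?U" for i j p
    using hC that by blast
  have F_cont: "continuous_on (closure ?U) F"
    by (rule C_closure_imp_continuous[OF C])
  have g_cont: "continuous_on (closure ?U) (g i)" if "i \<in> Basis" for i
    using C_closure_imp_continuous gC that by blast
  have h_cont: "continuous_on (closure ?U) (h i j)" if "i \<in> Basis" "j \<in> Basis" for i j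
    using C_closure_imp_continuous hC that by blast

  let ?V = "{0<..<T} \<times> - closure \<Omega>"
  have V: "open ?V" by (intro open_Times) auto
  have VU: "p \<in> ?U" if "p \<in> ?V" for p using that by auto
  have F_V: "F p = 0" if "p \<in> ?V" for p
    using outside[of "fst p" "snd p"] that closure_subset[of \<Omega>] unfolding F_def by fastforce
  have g_V: "g i p = 0" if "p \<in> ?V" "i \<in> Basis" for i p
    using directional_derivative_on_zero_set[OF V that(1) F_V g[OF that(2) VU[OF that(1)]]] .
  have h_V: "h i j p = 0" if "p \<in> ?V" "i \<in> Basis" "j \<in> Basis" for i j p
    using directional_derivative_on_zero_set[OF V that(1) g_V h[OF that(2,3) VU[OF that(1)]]] that(2)
    by blast
  have sub: "?K \<subseteq> closure ?U" unfolding clo by auto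
  obtain M1 where M1: "M1 \<ge> 0" "\<And>i p. i \<in> Basis \<Longrightarrow> p \<in> ?K \<Longrightarrow> norm (g i p) \<le> M1"
    by (rule compact_uniform_bound[OF finite_Basis K continuous_on_subset[OF g_cont sub]]) blast+
  have g_bound: "norm (g i p) \<le> M1" if "i \<in> Basis" "p \<in> ?U" for i p
    using M1(1) M1(2)[OF that(1), of p] g_V[OF _ that(1), of p] that(2)
    by (cases "snd p \<in> closure \<Omega>") (auto simp: mem_Times_iff)
  obtain M2 where M2: "M2 \<ge> 0" "\<And>ij p. ij \<in> Basis \<times> Basis \<Longrightarrow> p \<in> ?K \<Longrightarrow> norm ((case ij of (i, j) \<Rightarrow> h i j) p) \<le> M2"
  proof (rule compact_uniform_bound[where I = "Basis \<times> Basis" and K = ?K and G = "\<lambda>(i, j). h i j"])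
    show "continuous_on ?K (case ij of (i, j) \<Rightarrow> h i j)" if "ij \<in> Basis \<times> Basis" for ij
      using continuous_on_subset[OF h_cont sub] that by auto
  qed (use K in auto)
  have h_bound: "norm (h i j p) \<le> M2" if "i \<in> Basis" "j \<in> Basis" "p \<in> ?U" for i j p
    using M2(1) M2(2)[of "(i, j)" p] h_V[OF _ that(1,2), of p] that
    by (cases "snd p \<in> closure \<Omega>") (auto simp: mem_Times_iff)

  let ?d = "real DIM(real \<times> (real^3))"
  have F_lip: "norm (F q - F p) \<le> M1 * ?d * norm (q - p)" if "p \<in> closure ?U" "q \<in> closure ?U" for p q
    by (rule slab_lipschitz[OF F_cont _ M1(1) that]) (use g g_bound in blast)
  have g_lip: "norm (g i q - g i p) \<le> M2 * ?d * norm (q - p)"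
    if "i \<in> Basis" "p \<in> closure ?U" "q \<in> closure ?U" for i p q
    by (rule slab_lipschitz[OF g_cont[OF that(1)] _ M2(1) that(2,3)]) (use that(1) h h_bound in blast)
  have F_taylor: "norm (F q - F p - (\<Sum>i\<in>Basis. ((q - p) \<bullet> i) *\<^sub>R g i p)) \<le> M2 * ?d * (?d * norm (q - p))\<^sup>2"
    if "p \<in> closure ?U" "q \<in> closure ?U" for p q
  proof (rule slab_taylor[OF F_cont g_cont g _ _ that])
    show "norm (g i q - g i p) \<le> M2 * ?d * norm (q - p)" if "p \<in> ?U" "q \<in> ?U" "i \<in> Basis" for i p q
      using g_lip[OF that(3)] that(1,2) closure_subset[of ?U] by blast
  qed (use M2(1) in auto)

  \<comment> \<open>One dimension factor comes from the Lipschitz constant of the first derivatives,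
    two more from the square in the Taylor remainder; \<open>M1 * ?d\<close> is the Lipschitz
    constant of the solution.\<close>
  define L where "L = M2 * ?d ^ 3 + M1 * ?d"
  define ft where "ft t x = g (1, 0) (t, x)" for t x
  define fx where "fx t x = (\<chi> k. g (0, axis k 1) (t, x))" for t x
  have L: "0 \<le> L" "M2 * ?d ^ 3 \<le> L" "M1 * ?d \<le> L" using M1(1) M2(1) by (auto simp: L_def)
  have taylor: "\<bar>f t y - f s x - (t - s) * ft s x - fx s x \<bullet> (y - x)\<bar> \<le> L * (\<bar>t - s\<bar> + norm (y - x))\<^sup>2"
    if "s \<in> {0..T}" "t \<in> {0..T}" for s t x y
  proof -
    have "fx s x \<bullet> (y - x) = (\<Sum>k\<in>UNIV. ((y - x) $ k) * g (0, axis k 1) (s, x))"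
      by (simp add: fx_def inner_vec_def mult.commute)
    then have "(\<Sum>i\<in>Basis. (((t, y) - (s, x)) \<bullet> i) *\<^sub>R g i (s, x)) = (t - s) * ft s x + fx s x \<bullet> (y - x)"
      unfolding sum_Basis_time_space
      by (simp add: ft_def inner_axis)
    then have "\<bar>f t y - f s x - (t - s) * ft s x - fx s x \<bullet> (y - x)\<bar>
        \<le> M2 * ?d * (?d * norm ((t, y) - (s, x)))\<^sup>2"
      using F_taylor[of "(s, x)" "(t, y)"] that unfolding clo
      by (simp add: F_def algebra_simps del: DIM_prod DIM_cart)
    also have "\<dots> = M2 * ?d ^ 3 * (norm ((t, y) - (s, x)))\<^sup>2"
      by (simp add: power2_eq_square power3_eq_cube algebra_simps del: DIM_prod DIM_cart)
    also have "\<dots> \<le> L * (\<bar>t - s\<bar> + norm (y - x))\<^sup>2"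
      using norm_prod_le[of "(t, y) - (s, x)"] L by (intro mult_mono power_mono) auto
    finally show ?thesis .
  qed
  \<comment> \<open>At t = 0 and t = T the vector \<open>fx t x\<close> is only a continuous
    extension; that it is the gradient there follows from the Taylor estimate with equal
    times.\<close>
  have grad: "gradient (f t) x = fx t x" if t: "t \<in> {0..T}" for t x
  proof -
    have "((\<lambda>s. f t (x + s *\<^sub>R axis k 1)) has_real_derivative fx t x $ k) (at 0)" for k
    proof (rule has_real_derivative_of_quadratic_error[of UNIV])
      fix s :: real
      show "\<bar>f t (x + s *\<^sub>R axis k 1) - f t (x + 0 *\<^sub>R axis k 1) - (s - 0) * fx t x $ k\<bar> \<le> L * \<bar>s - 0\<bar>\<^sup>2"
        using taylor[OF t t, of "x + s *\<^sub>R axis k 1" x] by (simp add: inner_axis)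
    qed
    then show ?thesis
      by (simp add: gradient_def partial_deriv_def vec_eq_iff DERIV_imp_deriv)
  qed
  show thesis
  proof (rule that[of L ft])
    fix s x assume s: "s \<in> {0..T}"
    have "((\<lambda>t. f t x) has_real_derivative ft s x) (at s within {0..T})"
      using taylor[OF s, of _ x x] by (intro has_real_derivative_of_quadratic_error[of _ _ _ _ L]) auto
    then have "vector_derivative (\<lambda>t. f t x) (at s within cbox 0 T) = ft s x"
      using s T by (intro vector_derivative_within_cbox) (auto simp: has_real_derivative_iff_has_vector_derivative)
    moreover have "vector_derivative (\<lambda>t. f t x) (at s within {0..T}) + v s x \<bullet> gradient (f s) x = 0"
      using sol s unfolding transport_solution_def by blast
    ultimately show "ft s x + v s x \<bullet> gradient (f s) x = 0" by simp
  next
    fix t x y assume t: "t \<in> {0..T}"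
    have "\<bar>f t y - f t x\<bar> \<le> M1 * ?d * norm (y - x)"
      using F_lip[of "(t, x)" "(t, y)"] t unfolding clo by (simp add: F_def del: DIM_prod DIM_cart)
    also have "\<dots> \<le> L * norm (y - x)" using L by (intro mult_right_mono) auto
    finally show "\<bar>f t y - f t x\<bar> \<le> L * norm (y - x)" .
  next
    fix t assume t: "t \<in> {0..T}"
    have "continuous_on UNIV (\<lambda>x. g (0, axis k 1) (t, x))" for k :: 3
      by (rule continuous_on_compose2[OF g_cont]) (use t clo in \<open>auto simp: Basis_prod_def intro!: continuous_intros\<close>)
    then have "continuous_on UNIV (fx t)"
      unfolding fx_def by (intro continuous_on_vec_lambda) auto
    then show "continuous_on UNIV (gradient (f t))" using grad[OF t] by (simp cong: continuous_on_cong)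
  qed (use L taylor grad outside in auto)
qed

section \<open>Convergence of the scheme\<close>

text \<open>The half-open cell and the closed box differ by a subset of the box boundary, which is a
  null set.\<close>

lemma cell_integral_eq_cbox:
  fixes \<phi> :: "real^3 \<Rightarrow> 'b::banach"
  shows "integral (cell h x) \<phi> = integral (cbox (\<chi> i. x $ i - h / 2) (\<chi> i. x $ i + h / 2)) \<phi>"
proof (rule integral_subset_negligible)
  let ?a = "\<chi> i. x $ i - h / 2" and ?b = "\<chi> i. x $ i + h / 2"
  show "cell h x \<subseteq> cbox ?a ?b"
  proof
    fix y assume "y \<in> cell h x"
    then have "x $ i - h / 2 \<le> y $ i \<and> y $ i < x $ i + h / 2" for i by (simp add: cell_def)
    then show "y \<in> cbox ?a ?b" by (simp add: mem_box_cart less_imp_le)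
  qed
  have "cbox ?a ?b - cell h x \<subseteq> cbox ?a ?b - box ?a ?b"
    by (auto simp: cell_def mem_box_cart intro: less_imp_le)
  then show "negligible (cbox ?a ?b - cell h x)"
    using negligible_frontier_interval negligible_subset by blast
qed

text \<open>The radius 2h is a rounded value: coordinates deviate from the centre by at most h/2, so
  the l1 distance is at most 3h/2. The estimate is kept free of the division by h^3, as it is also
  integrated over time.\<close>

lemma cell_integral_error:
  fixes \<phi> :: "real^3 \<Rightarrow> real"
  assumes h: "0 < h" and cont: "continuous_on UNIV \<phi>"
    and error: "\<And>y. norm (y - x) \<le> 2 * h \<Longrightarrow> \<bar>\<phi> y - c\<bar> \<le> B"
  shows "\<bar>integral (cell h x) \<phi> - h ^ 3 * c\<bar> \<le> B * h ^ 3"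
proof -
  let ?a = "\<chi> i. x $ i - h / 2" and ?b = "\<chi> i. x $ i + h / 2"
  have "x \<in> cbox ?a ?b" using h by (simp add: mem_box_cart)
  then have content: "measure lborel (cbox ?a ?b) = h ^ 3"
    by (subst content_cbox_cart) auto
  have "(\<phi> has_integral integral (cell h x) \<phi>) (cbox ?a ?b)"
    unfolding cell_integral_eq_cbox using continuous_on_subset[OF cont]
    by (intro integrable_integral integrable_continuous) auto
  then have "((\<lambda>y. \<phi> y - c) has_integral integral (cell h x) \<phi> - h ^ 3 * c) (cbox ?a ?b)"
    using has_integral_const[of c ?a ?b] unfolding content by (auto intro: has_integral_diff)
  moreover have "norm (\<phi> y - c) \<le> B" if "y \<in> cbox ?a ?b" for y
  proof -
    have "\<bar>(y - x) $ i\<bar> \<le> h / 2" for i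
    proof -
      have "x $ i - h / 2 \<le> y $ i" "y $ i \<le> x $ i + h / 2"
        using that by (auto simp: mem_box_cart)
      then show ?thesis unfolding vector_minus_component by linarith
    qed
    then have "norm (y - x) \<le> (\<Sum>i\<in>(UNIV :: 3 set). h / 2)"
      by (intro order_trans[OF norm_le_l1_cart] sum_mono)
    also have "\<dots> \<le> 2 * h" using h by simp
    finally show ?thesis using error by simp
  qed
  moreover have "0 \<le> B" using error[of x] h by force
  ultimately have "norm (integral (cell h x) \<phi> - h ^ 3 * c) \<le> B * measure lborel (cbox ?a ?b)"
    by (intro has_integral_bound) auto
  then show ?thesis unfolding content by simp
qed

text \<open>The stencil is a set, so the sum splits only after its seven vectors are seen to be
  distinct.\<close>

lemma sum_stencil:
  fixes \<phi> :: "real^3 \<Rightarrow> 'c::comm_monoid_add"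
  shows "(\<Sum>\<omega>\<in>stencil. \<phi> \<omega>) = \<phi> 0 + (\<Sum>j\<in>UNIV. \<phi> (axis j 1) + \<phi> (- axis j 1))"
proof -
  have neq: "axis i (1::real) \<noteq> - axis j 1" for i j :: 3
    by (auto simp: axis_def vec_eq_iff)
  have nz: "axis i (1::real) \<noteq> 0" for i :: 3
    by (auto simp: axis_def vec_eq_iff)
  have "stencil = insert 0 (range (\<lambda>j. axis j 1) \<union> range (\<lambda>j. - axis j 1))"
    by (auto simp: stencil_def)
  also have "sum \<phi> \<dots> = \<phi> 0 + sum \<phi> (range (\<lambda>j. axis j 1) \<union> range (\<lambda>j. - axis j 1))"
    using nz by (subst sum.insert) auto
  also have "sum \<phi> (range (\<lambda>j. axis j 1) \<union> range (\<lambda>j. - axis j 1))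
      = sum \<phi> (range (\<lambda>j. axis j 1)) + sum \<phi> (range (\<lambda>j. - axis j 1))"
    using neq by (intro sum.union_disjoint) auto
  also have "sum \<phi> (range (\<lambda>j. axis j 1)) = (\<Sum>j\<in>UNIV. \<phi> (axis j 1))"
    by (subst sum.reindex) (auto simp: inj_on_def axis_eq_axis)
  also have "sum \<phi> (range (\<lambda>j. - axis j 1)) = (\<Sum>j\<in>UNIV. \<phi> (- axis j 1))"
    by (subst sum.reindex) (auto simp: inj_on_def axis_eq_axis)
  finally show ?thesis by (simp add: sum.distrib)
qed

lemma grid_shift: "x \<in> grid h \<Longrightarrow> \<omega> \<in> stencil \<Longrightarrow> x + h *\<^sub>R \<omega> \<in> grid h"
proof -
  assume x: "x \<in> grid h" and \<omega>: "\<omega> \<in> stencil"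
  have "\<exists>k::int. (x + h *\<^sub>R \<omega>) $ i = h * of_int k" for i
  proof -
    obtain k :: int where "x $ i = h * of_int k" using x by (auto simp: grid_def)
    moreover obtain m :: int where "\<omega> $ i = of_int m"
    proof -
      have "\<omega> $ i = of_int 0 \<or> \<omega> $ i = of_int 1 \<or> \<omega> $ i = of_int (-1)"
        using \<omega> by (auto simp: stencil_def axis_def split: if_splits)
      then show thesis using that by blast
    qed
    ultimately have "(x + h *\<^sub>R \<omega>) $ i = h * of_int (k + m)" by (simp add: algebra_simps)
    then show ?thesis by blast
  qed
  then show ?thesis by (simp add: grid_def)
qed

lemma axis_in_stencil: "axis j 1 \<in> stencil" "- axis j 1 \<in> stencil" "0 \<in> stencil"
  by (auto simp: stencil_def)

text \<open>The CFL condition makes one step of the scheme a convex combination of stencil values.\<close>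

lemma CFL_step_bound:
  fixes e :: "real^3 \<Rightarrow> real"
  assumes h: "0 < h"
    and cfl: "\<And>j. 1 / 7 + \<tau> / (2 * h) * u j \<ge> 0" "\<And>j. 1 / 7 - \<tau> / (2 * h) * u j \<ge> 0"
    and e: "\<And>\<omega>. \<omega> \<in> stencil \<Longrightarrow> \<bar>e (x + h *\<^sub>R \<omega>)\<bar> \<le> B"
  shows "\<bar>1 / 7 * (\<Sum>\<omega>\<in>stencil. e (x + h *\<^sub>R \<omega>)) - \<tau> * (\<Sum>j\<in>UNIV. u j * central_diff h j e x)\<bar> \<le> B"
proof -
  let ?p = "\<lambda>j. e (x + h *\<^sub>R axis j 1)" and ?m = "\<lambda>j. e (x - h *\<^sub>R axis j 1)"
  let ?k = "\<lambda>j. \<tau> / (2 * h) * u j"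
  have p: "\<bar>?p j\<bar> \<le> B" and m: "\<bar>?m j\<bar> \<le> B" and e0: "\<bar>e x\<bar> \<le> B" for j
    using e[of "axis j 1"] e[of "- axis j 1"] e[of 0] axis_in_stencil by auto
  have B: "0 \<le> B" using e0 by linarith
  have "1 / 7 * (\<Sum>\<omega>\<in>stencil. e (x + h *\<^sub>R \<omega>)) - \<tau> * (\<Sum>j\<in>UNIV. u j * central_diff h j e x)
      = 1 / 7 * e x + (\<Sum>j\<in>UNIV. (1 / 7 - ?k j) * ?p j + (1 / 7 + ?k j) * ?m j)"
    unfolding sum_stencil central_diff_def
    by (simp add: sum_distrib_left sum.distrib sum_subtractf algebra_simps diff_divide_distrib add_divide_distrib sum_divide_distrib)
  \<comment> \<open>The two weights of each direction are nonnegative by CFL and add up to 2/7. With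
    1/7 for the centre the total weight is 1, so a step does not enlarge the bound.\<close>
  moreover have "\<bar>(1 / 7 - ?k j) * ?p j + (1 / 7 + ?k j) * ?m j\<bar> \<le> 2 / 7 * B" for j
  proof -
    have "\<bar>(1 / 7 - ?k j) * ?p j + (1 / 7 + ?k j) * ?m j\<bar> \<le> \<bar>(1 / 7 - ?k j) * ?p j\<bar> + \<bar>(1 / 7 + ?k j) * ?m j\<bar>"
      by (rule abs_triangle_ineq)
    also have "\<dots> \<le> (1 / 7 - ?k j) * B + (1 / 7 + ?k j) * B"
      unfolding abs_mult using cfl[of j] p[of j] m[of j] by (intro add_mono mult_mono) auto
    also have "\<dots> = 2 / 7 * B" by (simp add: algebra_simps)
    finally show ?thesis .
  qed
  then have "\<bar>\<Sum>j\<in>UNIV. (1 / 7 - ?k j) * ?p j + (1 / 7 + ?k j) * ?m j\<bar> \<le> (\<Sum>j\<in>(UNIV::3 set). 2 / 7 * B)"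
    by (intro order_trans[OF sum_abs] sum_mono)
  ultimately show ?thesis
    using e0 abs_triangle_ineq[of "1 / 7 * e x" "\<Sum>j\<in>UNIV. (1 / 7 - ?k j) * ?p j + (1 / 7 + ?k j) * ?m j"]
    by (simp add: abs_mult)
qed

text \<open>Collects the quantitative facts about the data in which \<open>ft\<close> and
  \<open>fx\<close> appear only as Taylor coefficients. A single constant serves all estimates, and
  L \<ge> 1 allows lower powers of L to be absorbed into higher ones.\<close>

locale regular_transport =
  fixes T L :: real
    and v :: "real \<Rightarrow> real^3 \<Rightarrow> real^3"
    and f ft :: "real \<Rightarrow> real^3 \<Rightarrow> real"
    and fx :: "real \<Rightarrow> real^3 \<Rightarrow> real^3"
  assumes T_pos: "0 < T" and L_ge_1: "1 \<le> L"
    and v_lipschitz: "\<And>s t x y. s \<in> {0..T} \<Longrightarrow> t \<in> {0..T} \<Longrightarrow>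
      norm (v t y - v s x) \<le> L * (\<bar>t - s\<bar> + norm (y - x))"
    and v_bound: "\<And>t x. t \<in> {0..T} \<Longrightarrow> norm (v t x) \<le> L"
    and taylor: "\<And>s t x y. s \<in> {0..T} \<Longrightarrow> t \<in> {0..T} \<Longrightarrow>
      \<bar>f t y - f s x - (t - s) * ft s x - fx s x \<bullet> (y - x)\<bar> \<le> L * (\<bar>t - s\<bar> + norm (y - x))\<^sup>2"
    and transport: "\<And>s x. s \<in> {0..T} \<Longrightarrow> ft s x + v s x \<bullet> fx s x = 0"
    and f_lipschitz: "\<And>t x y. t \<in> {0..T} \<Longrightarrow> \<bar>f t y - f t x\<bar> \<le> L * norm (y - x)"
begin

lemma f_continuous: "t \<in> {0..T} \<Longrightarrow> continuous_on S (f t)"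
  using f_lipschitz L_ge_1
  by (intro lipschitz_on_continuous_on[of L] lipschitz_onI) (auto simp: dist_norm)

lemma v_continuous: "continuous_on ({0..T} \<times> S) (\<lambda>(t, x). v t x)"
proof (rule lipschitz_on_continuous_on[of "2 * L"], rule lipschitz_onI, clarsimp)
  fix s t x y assume "0 \<le> s" "s \<le> T" "0 \<le> t" "t \<le> T"
  then have "norm (v s x - v t y) \<le> L * (\<bar>s - t\<bar> + norm (x - y))"
    by (intro v_lipschitz) auto
  also have "\<dots> \<le> L * (2 * dist (s, x) (t, y))"
    using L_ge_1 dist_fst_le[of "(s, x)" "(t, y)"] dist_snd_le[of "(s, x)" "(t, y)"]
    by (intro mult_left_mono) (auto simp: dist_norm)
  finally show "dist (v s x) (v t y) \<le> 2 * L * dist (s, x) (t, y)"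
    by (simp add: dist_norm)
qed (use L_ge_1 in auto)

text \<open>Every point averaged over is within \<tau> in time and 2h in space of the reference
  point, so the Lipschitz bound passes to the mean. The whole time step has to lie in [0,T], whence
  the \<open>n + 1\<close>.\<close>

lemma averaged_velocity_error:
  assumes h: "0 < h" and \<tau>: "0 < \<tau>" and n: "\<tau> * real (n + 1) \<le> T"
  shows "\<bar>averaged_velocity h \<tau> v n j x - v (\<tau> * real n) x $ j\<bar> \<le> L * (\<tau> + 2 * h)"
proof -
  let ?t = "\<tau> * real n" and ?t' = "\<tau> * real (n + 1)"
  let ?I = "\<lambda>s. integral (cell h x) (\<lambda>y. v s y $ j)"
  have step: "?t' = ?t + \<tau>" by (simp add: algebra_simps)
  have t: "0 \<le> ?t" using \<tau> by simp
  have sub: "s \<in> {0..T}" if "s \<in> {?t..?t'}" for s using that t n by auto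
  have v_cont: "continuous_on (A \<times> B) (\<lambda>(s, y). v s y $ j)" if "A \<subseteq> {0..T}" for A B
    using continuous_on_subset[OF v_continuous[of B], of "A \<times> B"] that
    by (auto simp: case_prod_unfold intro!: continuous_intros)
  have I: "continuous_on {?t..?t'} ?I"
    unfolding cell_integral_eq_cbox using sub by (intro integral_continuous_on_param v_cont) blast
  have "norm (integral {?t..?t'} (\<lambda>s. ?I s - h ^ 3 * v ?t x $ j)) \<le> (L * (\<tau> + 2 * h) * h ^ 3) * (?t' - ?t)"
  proof (rule integral_bound)
    show "norm (?I s - h ^ 3 * v ?t x $ j) \<le> L * (\<tau> + 2 * h) * h ^ 3" if s: "s \<in> {?t..?t'}" for s
      unfolding real_norm_def
    proof (rule cell_integral_error[OF h])
      show "continuous_on UNIV (\<lambda>y. v s y $ j)"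
      proof -
        have "continuous_on UNIV (\<lambda>y. case (s, y) of (s, y) \<Rightarrow> v s y $ j)"
          by (rule continuous_on_compose2[OF v_cont[of "{s}" UNIV]])
            (use sub[OF s] in \<open>auto intro!: continuous_intros\<close>)
        then show ?thesis by simp
      qed
    next
      fix y assume y: "norm (y - x) \<le> 2 * h"
      have "\<bar>v s y $ j - v ?t x $ j\<bar> \<le> norm (v s y - v ?t x)"
        using component_le_norm_cart[of "v s y - v ?t x" j] by simp
      also have "\<dots> \<le> L * (\<bar>s - ?t\<bar> + norm (y - x))"
        using s sub step \<tau> by (intro v_lipschitz) auto
      also have "\<dots> \<le> L * (\<tau> + 2 * h)"
        using y s step L_ge_1 by (intro mult_left_mono) auto
      finally show "\<bar>v s y $ j - v ?t x $ j\<bar> \<le> L * (\<tau> + 2 * h)" .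
    qed
  qed (use I step \<tau> in \<open>auto intro!: continuous_intros\<close>)
  also have "integral {?t..?t'} (\<lambda>s. ?I s - h ^ 3 * v ?t x $ j) = integral {?t..?t'} ?I - \<tau> * h ^ 3 * v ?t x $ j"
    using I step \<tau> by (subst integral_diff) (auto intro: integrable_continuous_real)
  finally have "\<bar>integral {?t..?t'} ?I - \<tau> * h ^ 3 * v ?t x $ j\<bar> \<le> L * (\<tau> + 2 * h) * (\<tau> * h ^ 3)"
    using step by (simp add: algebra_simps)
  moreover have "averaged_velocity h \<tau> v n j x - v ?t x $ j
      = (integral {?t..?t'} ?I - \<tau> * h ^ 3 * v ?t x $ j) / (\<tau> * h ^ 3)"
    using h \<tau> by (simp add: averaged_velocity_def field_simps)
  moreover have "0 < \<tau> * h ^ 3" using h \<tau> by simp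
  ultimately show ?thesis
    by (simp add: abs_divide pos_divide_le_eq)
qed

text \<open>The truncation error of one step has three sources: the time increment gives \<tau>^2,
  the averaging gives h^2 since opposite first-order terms cancel, and advection gives \<tau> times
  an error of order \<tau> + h.\<close>

lemma consistency_error:
  assumes h: "0 < h" and \<tau>: "0 < \<tau>" and t: "0 \<le> t" "t + \<tau> \<le> T"
    and u: "\<And>j. \<bar>u j - v t x $ j\<bar> \<le> L * (\<tau> + 2 * h)"
  shows "\<bar>f (t + \<tau>) x - 1 / 7 * (\<Sum>\<omega>\<in>stencil. f t (x + h *\<^sub>R \<omega>))
      + \<tau> * (\<Sum>j\<in>UNIV. u j * central_diff h j (f t) x)\<bar> \<le> 10 * L\<^sup>2 * (\<tau>\<^sup>2 + h\<^sup>2 + \<tau> * h)"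
proof -
  let ?p = "\<lambda>j. f t (x + h *\<^sub>R axis j 1)" and ?m = "\<lambda>j. f t (x - h *\<^sub>R axis j 1)"
  let ?d = "\<lambda>j. fx t x $ j" and ?D = "\<lambda>j. central_diff h j (f t) x"
  have tT: "t \<in> {0..T}" "t + \<tau> \<in> {0..T}" using t \<tau> by auto
  have p: "\<bar>?p j - f t x - h * ?d j\<bar> \<le> L * h\<^sup>2" for j
    using taylor[OF tT(1) tT(1), of "x + h *\<^sub>R axis j 1" x] h by (simp add: inner_axis)
  have m: "\<bar>?m j - f t x + h * ?d j\<bar> \<le> L * h\<^sup>2" for j
    using taylor[OF tT(1) tT(1), of "x - h *\<^sub>R axis j 1" x] h by (simp add: inner_axis)
  have D: "\<bar>?D j - ?d j\<bar> \<le> L * h" for j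
  proof -
    have "?D j - ?d j = ((?p j - f t x - h * ?d j) - (?m j - f t x + h * ?d j)) / (2 * h)"
      using h by (simp add: central_diff_def field_simps)
    moreover have "\<bar>(?p j - f t x - h * ?d j) - (?m j - f t x + h * ?d j)\<bar> \<le> 2 * (L * h\<^sup>2)"
      using p[of j] m[of j] by linarith
    moreover have "2 * (L * h\<^sup>2) = L * h * (2 * h)" by (simp add: power2_eq_square)
    ultimately show ?thesis using h by (simp add: abs_divide pos_divide_le_eq)
  qed
  have D_bound: "\<bar>?D j\<bar> \<le> L" for j
  proof -
    have "\<bar>?p j - ?m j\<bar> \<le> L * norm ((x + h *\<^sub>R axis j 1) - (x - h *\<^sub>R axis j 1))"
      using f_lipschitz[OF tT(1)] .
    also have "(x + h *\<^sub>R axis j 1) - (x - h *\<^sub>R axis j 1) = (2 * h) *\<^sub>R axis j 1"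
      by (simp add: scaleR_2[symmetric])
    finally show ?thesis using h by (simp add: central_diff_def abs_divide pos_divide_le_eq)
  qed
  have time: "\<bar>f (t + \<tau>) x - f t x - \<tau> * ft t x\<bar> \<le> L * \<tau>\<^sup>2"
    using taylor[OF tT, of x x] by simp
  have space: "\<bar>f t x - 1 / 7 * (\<Sum>\<omega>\<in>stencil. f t (x + h *\<^sub>R \<omega>))\<bar> \<le> L * h\<^sup>2"
  proof -
    have "f t x - 1 / 7 * (\<Sum>\<omega>\<in>stencil. f t (x + h *\<^sub>R \<omega>))
        = - 1 / 7 * (\<Sum>j\<in>UNIV. (?p j - f t x - h * ?d j) + (?m j - f t x + h * ?d j))"
      unfolding sum_stencil by (simp add: sum.distrib sum_subtractf) (simp add: field_simps)
    moreover have "\<bar>\<Sum>j\<in>UNIV. (?p j - f t x - h * ?d j) + (?m j - f t x + h * ?d j)\<bar>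
        \<le> (\<Sum>j\<in>(UNIV::3 set). 2 * (L * h\<^sup>2))"
    proof (intro order_trans[OF sum_abs] sum_mono)
      show "\<bar>(?p j - f t x - h * ?d j) + (?m j - f t x + h * ?d j)\<bar> \<le> 2 * (L * h\<^sup>2)" for j
        using p[of j] m[of j] by linarith
    qed
    moreover have "0 \<le> L * h\<^sup>2" using L_ge_1 by simp
    ultimately show ?thesis by (simp add: abs_mult)
  qed
  have advection: "\<bar>ft t x + (\<Sum>j\<in>UNIV. u j * ?D j)\<bar> \<le> 3 * L\<^sup>2 * (\<tau> + 3 * h)"
  proof -
    have "ft t x = - (\<Sum>j\<in>UNIV. v t x $ j * ?d j)"
      using transport[OF tT(1), of x] by (simp add: inner_vec_def)
    \<comment> \<open>The transport equation replaces the time derivative; the remainder splits into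
      a velocity error and a difference-quotient error.\<close>
    then have "ft t x + (\<Sum>j\<in>UNIV. u j * ?D j) = (\<Sum>j\<in>UNIV. (u j - v t x $ j) * ?D j + v t x $ j * (?D j - ?d j))"
      by (simp add: sum.distrib sum_subtractf algebra_simps)
    also have "\<bar>\<dots>\<bar> \<le> (\<Sum>j\<in>(UNIV::3 set). L * (\<tau> + 2 * h) * L + L * (L * h))"
    proof (intro order_trans[OF sum_abs] sum_mono)
      fix j
      have vj: "\<bar>v t x $ j\<bar> \<le> L"
        using component_le_norm_cart[of "v t x" j] v_bound[OF tT(1), of x] by linarith
      have "\<bar>(u j - v t x $ j) * ?D j + v t x $ j * (?D j - ?d j)\<bar>
          \<le> \<bar>u j - v t x $ j\<bar> * \<bar>?D j\<bar> + \<bar>v t x $ j\<bar> * \<bar>?D j - ?d j\<bar>"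
        unfolding abs_mult[symmetric] by (rule abs_triangle_ineq)
      also have "\<dots> \<le> L * (\<tau> + 2 * h) * L + L * (L * h)"
        using u[of j] D[of j] D_bound[of j] vj L_ge_1 h \<tau> by (intro add_mono mult_mono) auto
      finally show "\<bar>(u j - v t x $ j) * ?D j + v t x $ j * (?D j - ?d j)\<bar> \<le> L * (\<tau> + 2 * h) * L + L * (L * h)" .
    qed
    also have "\<dots> = 3 * L\<^sup>2 * (\<tau> + 3 * h)" by (simp add: power2_eq_square algebra_simps)
    finally show ?thesis .
  qed
  have "f (t + \<tau>) x - 1 / 7 * (\<Sum>\<omega>\<in>stencil. f t (x + h *\<^sub>R \<omega>)) + \<tau> * (\<Sum>j\<in>UNIV. u j * ?D j)
      = (f (t + \<tau>) x - f t x - \<tau> * ft t x) + (f t x - 1 / 7 * (\<Sum>\<omega>\<in>stencil. f t (x + h *\<^sub>R \<omega>)))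
        + \<tau> * (ft t x + (\<Sum>j\<in>UNIV. u j * ?D j))"
    by (simp add: algebra_simps)
  moreover have "\<bar>\<tau> * (ft t x + (\<Sum>j\<in>UNIV. u j * ?D j))\<bar> \<le> \<tau> * (3 * L\<^sup>2 * (\<tau> + 3 * h))"
    using advection \<tau> by (simp add: abs_mult)
  ultimately have "\<bar>f (t + \<tau>) x - 1 / 7 * (\<Sum>\<omega>\<in>stencil. f t (x + h *\<^sub>R \<omega>)) + \<tau> * (\<Sum>j\<in>UNIV. u j * ?D j)\<bar>
      \<le> L * \<tau>\<^sup>2 + L * h\<^sup>2 + \<tau> * (3 * L\<^sup>2 * (\<tau> + 3 * h))"
    using time space by linarith
  also have "\<dots> \<le> L\<^sup>2 * \<tau>\<^sup>2 + L\<^sup>2 * h\<^sup>2 + \<tau> * (3 * L\<^sup>2 * (\<tau> + 3 * h))"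
    using L_ge_1 by (intro add_mono mult_right_mono order_refl) (auto simp: power2_eq_square)
  also have "\<dots> = 4 * (L\<^sup>2 * \<tau>\<^sup>2) + L\<^sup>2 * h\<^sup>2 + 9 * (L\<^sup>2 * (\<tau> * h))"
    by (simp add: power2_eq_square algebra_simps)
  \<comment> \<open>The coefficients 4, 1 and 9 are rounded up to the common value 10.\<close>
  also have "\<dots> \<le> 10 * L\<^sup>2 * (\<tau>\<^sup>2 + h\<^sup>2 + \<tau> * h)"
    using L_ge_1 h \<tau> by (simp add: algebra_simps)
  finally show ?thesis .
qed

text \<open>By linearity the error obeys the same scheme with the truncation error as source, and a
  CFL step does not amplify it. Each step thus adds one truncation error to the initial 2Lh of the
  cell average. The bound is proved at all grid points together because the stencil reaches the
  neighbours.\<close>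

lemma scheme_error:
  assumes h: "0 < h" and \<tau>: "0 < \<tau>" and N: "\<tau> * real N \<le> T"
    and cfl: "CFL_condition h \<tau> N v" and scheme: "explicit_scheme h \<tau> N v (f 0) g"
    and n: "n \<le> N" and x: "x \<in> grid h"
  shows "\<bar>g n x - f (\<tau> * real n) x\<bar> \<le> 2 * L * h + real n * (10 * L\<^sup>2 * (\<tau>\<^sup>2 + h\<^sup>2 + \<tau> * h))"
  using n x
proof (induction n arbitrary: x)
  case 0
  have "\<bar>integral (cell h x) (f 0) - h ^ 3 * f 0 x\<bar> \<le> (L * (2 * h)) * h ^ 3"
  proof (rule cell_integral_error[OF h])
    show "continuous_on UNIV (f 0)" using T_pos by (intro f_continuous) auto
    fix y assume y: "norm (y - x) \<le> 2 * h"
    have "\<bar>f 0 y - f 0 x\<bar> \<le> L * norm (y - x)" using T_pos by (intro f_lipschitz) auto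
    also have "\<dots> \<le> L * (2 * h)" using y L_ge_1 by (intro mult_left_mono) auto
    finally show "\<bar>f 0 y - f 0 x\<bar> \<le> L * (2 * h)" .
  qed
  moreover have "g 0 x - f 0 x = (integral (cell h x) (f 0) - h ^ 3 * f 0 x) / h ^ 3"
    using scheme 0 h by (simp add: explicit_scheme_def diff_divide_distrib)
  ultimately show ?case using h by (simp add: abs_divide pos_divide_le_eq mult_ac)
next
  case (Suc n)
  let ?t = "\<tau> * real n" and ?u = "\<lambda>j. averaged_velocity h \<tau> v n j x"
  let ?e = "\<lambda>y. g n y - f ?t y"
  let ?B = "2 * L * h + real n * (10 * L\<^sup>2 * (\<tau>\<^sup>2 + h\<^sup>2 + \<tau> * h))"
  have "n < N" using Suc by simp
  have "\<tau> * real (n + 1) \<le> \<tau> * real N" using \<open>n < N\<close> \<tau> by (intro mult_left_mono) auto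
  then have nT: "\<tau> * real (n + 1) \<le> T" using N by linarith
  have time: "\<tau> * real (Suc n) = ?t + \<tau>" by (simp add: algebra_simps)
  have "(g (Suc n) x - 1 / 7 * (\<Sum>\<omega>\<in>stencil. g n (x + h *\<^sub>R \<omega>))) * (1 / \<tau>)
      + (\<Sum>j\<in>UNIV. ?u j * central_diff h j (g n) x) = 0"
    using scheme \<open>n < N\<close> Suc.prems unfolding explicit_scheme_def by blast
  then have "g (Suc n) x = 1 / 7 * (\<Sum>\<omega>\<in>stencil. g n (x + h *\<^sub>R \<omega>))
      - \<tau> * (\<Sum>j\<in>UNIV. ?u j * central_diff h j (g n) x)"
    using \<tau> by (simp add: field_simps)
  moreover have "central_diff h j (g n) x = central_diff h j ?e x + central_diff h j (f ?t) x" for j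
    by (simp add: central_diff_def diff_divide_distrib)
  ultimately have "g (Suc n) x - f (?t + \<tau>) x
      = (1 / 7 * (\<Sum>\<omega>\<in>stencil. ?e (x + h *\<^sub>R \<omega>)) - \<tau> * (\<Sum>j\<in>UNIV. ?u j * central_diff h j ?e x))
        - (f (?t + \<tau>) x - 1 / 7 * (\<Sum>\<omega>\<in>stencil. f ?t (x + h *\<^sub>R \<omega>))
          + \<tau> * (\<Sum>j\<in>UNIV. ?u j * central_diff h j (f ?t) x))"
    by (simp add: sum.distrib sum_subtractf algebra_simps)
  moreover have "\<bar>1 / 7 * (\<Sum>\<omega>\<in>stencil. ?e (x + h *\<^sub>R \<omega>)) - \<tau> * (\<Sum>j\<in>UNIV. ?u j * central_diff h j ?e x)\<bar> \<le> ?B"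
  proof (rule CFL_step_bound[OF h])
    show "0 \<le> 1 / 7 + \<tau> / (2 * h) * ?u j" "0 \<le> 1 / 7 - \<tau> / (2 * h) * ?u j" for j
      using cfl \<open>n < N\<close> Suc.prems unfolding CFL_condition_def by blast+
    show "\<bar>?e (x + h *\<^sub>R \<omega>)\<bar> \<le> ?B" if "\<omega> \<in> stencil" for \<omega>
      using Suc.IH[of "x + h *\<^sub>R \<omega>"] Suc.prems grid_shift that by auto
  qed
  moreover have "\<bar>f (?t + \<tau>) x - 1 / 7 * (\<Sum>\<omega>\<in>stencil. f ?t (x + h *\<^sub>R \<omega>))
      + \<tau> * (\<Sum>j\<in>UNIV. ?u j * central_diff h j (f ?t) x)\<bar> \<le> 10 * L\<^sup>2 * (\<tau>\<^sup>2 + h\<^sup>2 + \<tau> * h)"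
    using averaged_velocity_error[OF h \<tau> nT] nT \<tau> time
    by (intro consistency_error[OF h \<tau>]) auto
  ultimately have "\<bar>g (Suc n) x - f (?t + \<tau>) x\<bar> \<le> ?B + 10 * L\<^sup>2 * (\<tau>\<^sup>2 + h\<^sup>2 + \<tau> * h)"
    by linarith
  then show ?case unfolding time by (simp add: algebra_simps)
qed

text \<open>Since n\<tau> \<le> T, the accumulated error is at most a multiple of \<tau> +
  h^2/\<tau> + h. The summands C, 1/c and 1 of the constant belong to these three terms in this
  order.\<close>

lemma scheme_convergence:
  assumes h: "0 < h" "h \<le> 1" and \<tau>: "0 < \<tau>" and N: "\<tau> * real N \<le> T"
    and \<alpha>: "0 < \<alpha>" "\<alpha> \<le> 1" and c: "0 < c" "0 < C"
    and scale: "c * h powr (2 - \<alpha>) \<le> \<tau>" "\<tau> \<le> C * h powr (2 - \<alpha>)"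
    and cfl: "CFL_condition h \<tau> N v" and scheme: "explicit_scheme h \<tau> N v (f 0) g"
    and n: "n \<le> N" and x: "x \<in> grid h"
  shows "\<bar>g n x - f (\<tau> * real n) x\<bar> \<le> (2 * L + 10 * L\<^sup>2 * T * (C + 1 / c + 1)) * h powr \<alpha>"
proof -
  have h_le: "h \<le> h powr \<alpha>"
    using powr_mono'[of \<alpha> 1 h] h \<alpha> by simp
  have \<tau>_le: "\<tau> \<le> C * h powr \<alpha>"
  proof -
    have "h powr (2 - \<alpha>) \<le> h powr \<alpha>" using powr_mono'[of \<alpha> "2 - \<alpha>" h] h \<alpha> by simp
    then show ?thesis using scale(2) c by (meson mult_left_mono order_trans less_imp_le)
  qed
  have h2: "h\<^sup>2 \<le> \<tau> * (1 / c * h powr \<alpha>)"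
  proof -
    have "h\<^sup>2 = h powr (2 - \<alpha>) * h powr \<alpha>"
      using h by (simp add: powr_add[symmetric])
    also have "\<dots> \<le> \<tau> / c * h powr \<alpha>"
      using scale(1) c by (intro mult_right_mono) (auto simp: pos_le_divide_eq mult.commute)
    finally show ?thesis by simp
  qed
  have nT: "real n * \<tau> \<le> T"
  proof -
    have "real n * \<tau> \<le> real N * \<tau>" using n \<tau> by (intro mult_right_mono) auto
    then show ?thesis using N by (simp add: mult.commute)
  qed
  have "\<tau>\<^sup>2 + h\<^sup>2 + \<tau> * h \<le> \<tau> * (C * h powr \<alpha>) + \<tau> * (1 / c * h powr \<alpha>) + \<tau> * h powr \<alpha>"
    unfolding power2_eq_square[of \<tau>] using \<tau>_le h2 h_le \<tau> by (intro add_mono mult_left_mono) auto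
  also have "\<dots> = \<tau> * ((C + 1 / c + 1) * h powr \<alpha>)" by (simp add: algebra_simps)
  finally have "real n * (10 * L\<^sup>2 * (\<tau>\<^sup>2 + h\<^sup>2 + \<tau> * h)) \<le> real n * (10 * L\<^sup>2 * (\<tau> * ((C + 1 / c + 1) * h powr \<alpha>)))"
    by (intro mult_left_mono) auto
  also have "\<dots> = (real n * \<tau>) * (10 * L\<^sup>2 * ((C + 1 / c + 1) * h powr \<alpha>))" by simp
  also have "\<dots> \<le> T * (10 * L\<^sup>2 * ((C + 1 / c + 1) * h powr \<alpha>))"
    using nT c by (intro mult_right_mono mult_nonneg_nonneg) auto
  finally have "real n * (10 * L\<^sup>2 * (\<tau>\<^sup>2 + h\<^sup>2 + \<tau> * h)) \<le> 10 * L\<^sup>2 * T * (C + 1 / c + 1) * h powr \<alpha>"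
    by (simp add: mult_ac)
  moreover have "2 * L * h \<le> 2 * L * h powr \<alpha>" using h_le L_ge_1 by simp
  ultimately show ?thesis
    using scheme_error[OF h(1) \<tau> N cfl scheme n x] by (simp add: algebra_simps)
qed

end

section \<open>Distance to the level set\<close>

text \<open>By compactness the deviation from 1 and the gradient cannot both be small. Near level 1
  the gradient is therefore bounded below, and moving by a multiple of \<epsilon> along plus or
  minus its direction makes \<phi> cross 1; the intermediate value theorem yields the point.\<close>

lemma level_set_metric_regularity:
  fixes \<phi> :: "'a::euclidean_space \<Rightarrow> real" and G :: "'a \<Rightarrow> 'a"
  assumes S: "compact S" and outside: "\<And>x. x \<notin> S \<Longrightarrow> \<phi> x = 0"
    and \<phi>: "continuous_on UNIV \<phi>" and G: "continuous_on UNIV G"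
    and L: "0 < L" and taylor: "\<And>x y. \<bar>\<phi> y - \<phi> x - G x \<bullet> (y - x)\<bar> \<le> L * (norm (y - x))\<^sup>2"
    and nondegenerate: "\<And>x. \<phi> x = 1 \<Longrightarrow> G x \<noteq> 0"
  obtains K \<epsilon>0 where "0 < K" "0 < \<epsilon>0"
    "\<And>y \<epsilon>. 0 < \<epsilon> \<Longrightarrow> \<epsilon> \<le> \<epsilon>0 \<Longrightarrow> \<bar>\<phi> y - 1\<bar> \<le> \<epsilon> \<Longrightarrow> \<exists>p. \<phi> p = 1 \<and> norm (p - y) \<le> K * \<epsilon>"
proof -
  obtain q where q: "0 < q" "\<And>x. x \<in> S \<Longrightarrow> q \<le> \<bar>\<phi> x - 1\<bar> + norm (G x)"
  proof (cases "S = {}")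
    case False
    have "continuous_on S (\<lambda>x. \<bar>\<phi> x - 1\<bar> + norm (G x))"
      by (intro continuous_intros continuous_on_subset[OF \<phi>] continuous_on_subset[OF G]) auto
    from continuous_attains_inf[OF S False this] obtain z where
      z: "\<And>x. x \<in> S \<Longrightarrow> \<bar>\<phi> z - 1\<bar> + norm (G z) \<le> \<bar>\<phi> x - 1\<bar> + norm (G x)"
      by blast
    have "0 < \<bar>\<phi> z - 1\<bar> + norm (G z)"
      using nondegenerate[of z] by (cases "\<phi> z = 1") (auto intro: add_pos_nonneg)
    from this z show thesis by (rule that)
  qed (auto intro: that[of 1])
  define \<gamma> where "\<gamma> = q / 2"
  \<comment> \<open>The bound 1/2 forces y into S, as \<phi> is 0 elsewhere; \<gamma> leaves a
    gradient of at least q - q/2; the third bound makes the Taylor remainder at distance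
    \<open>2 * \<epsilon> / \<gamma>\<close> at most \<epsilon>.\<close>
  define \<epsilon>0 where "\<epsilon>0 = Min {1 / 2, \<gamma>, \<gamma>\<^sup>2 / (4 * L)}"
  have \<gamma>: "0 < \<gamma>" using q by (simp add: \<gamma>_def)
  have \<epsilon>0: "\<epsilon>0 \<le> 1 / 2" "\<epsilon>0 \<le> \<gamma>" "\<epsilon>0 \<le> \<gamma>\<^sup>2 / (4 * L)" "0 < \<epsilon>0"
    using \<gamma> L by (auto simp: \<epsilon>0_def)
  show thesis
  proof
    show "0 < 2 / \<gamma>" "0 < \<epsilon>0" using \<gamma> \<epsilon>0 by auto
    fix y \<epsilon> assume \<epsilon>: "0 < \<epsilon>" "\<epsilon> \<le> \<epsilon>0" and y: "\<bar>\<phi> y - 1\<bar> \<le> \<epsilon>"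
    have "y \<in> S" using outside[of y] y \<epsilon> \<epsilon>0(1) by (cases "y \<in> S") auto
    then have Gy: "\<gamma> \<le> norm (G y)" using q(2)[of y] y \<epsilon> \<epsilon>0(2) by (simp add: \<gamma>_def)
    define n where "n = sgn (G y)"
    define r where "r = 2 * \<epsilon> / \<gamma>"
    have n: "norm n = 1" "G y \<bullet> n = norm (G y)"
    proof -
      have "G y \<noteq> 0" using Gy \<gamma> by auto
      then show "norm n = 1" "G y \<bullet> n = norm (G y)"
        by (simp_all add: n_def norm_sgn) (simp add: sgn_div_norm dot_square_norm power2_eq_square)
    qed
    have r: "0 < r" using \<epsilon> \<gamma> by (simp add: r_def)
    have "L * r\<^sup>2 \<le> \<epsilon>"
    proof -
      have "\<epsilon> \<le> \<gamma>\<^sup>2 / (4 * L)" using \<epsilon> \<epsilon>0(3) by linarith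
      then have "\<epsilon> * (4 * L) \<le> \<gamma>\<^sup>2" using L by (simp add: pos_le_divide_eq)
      then have "\<epsilon> * (\<epsilon> * (4 * L)) \<le> \<epsilon> * \<gamma>\<^sup>2" using \<epsilon> by (intro mult_left_mono) auto
      then show ?thesis using \<gamma> by (simp add: r_def power2_eq_square divide_simps algebra_simps)
    qed
    moreover have "2 * \<epsilon> \<le> r * norm (G y)"
    proof -
      have "2 * \<epsilon> = r * \<gamma>" using \<gamma> by (simp add: r_def)
      also have "\<dots> \<le> r * norm (G y)" using Gy r by simp
      finally show ?thesis .
    qed
    moreover have "\<bar>\<phi> (y + s *\<^sub>R n) - \<phi> y - s * norm (G y)\<bar> \<le> L * s\<^sup>2" for s
      using taylor[of "y + s *\<^sub>R n" y] n by simp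
    from this[of r] this[of "- r"]
    have "\<bar>\<phi> (y + r *\<^sub>R n) - \<phi> y - r * norm (G y)\<bar> \<le> L * r\<^sup>2"
      "\<bar>\<phi> (y + (- r) *\<^sub>R n) - \<phi> y + r * norm (G y)\<bar> \<le> L * r\<^sup>2" by simp_all
    \<comment> \<open>The linear change is at least 2\<epsilon>: one \<epsilon> pays for the
      remainder, the other for the deviation of \<phi> at y from 1.\<close>
    ultimately have "\<phi> (y + (- r) *\<^sub>R n) \<le> 1" "1 \<le> \<phi> (y + r *\<^sub>R n)"
      using y by linarith+
    moreover have "continuous_on {- r..r} (\<lambda>s. \<phi> (y + s *\<^sub>R n))"
      by (rule continuous_on_compose2[OF \<phi>]) (auto intro!: continuous_intros)
    ultimately obtain s where s: "- r \<le> s" "s \<le> r" "\<phi> (y + s *\<^sub>R n) = 1"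
      using IVT'[of "\<lambda>s. \<phi> (y + s *\<^sub>R n)" "- r" 1 r] r by auto
    have "norm ((y + s *\<^sub>R n) - y) \<le> 2 / \<gamma> * \<epsilon>"
      using s n by (simp add: r_def abs_le_iff)
    with s(3) show "\<exists>p. \<phi> p = 1 \<and> norm (p - y) \<le> 2 / \<gamma> * \<epsilon>" by blast
  qed
qed

section \<open>Transport of level points along approximate characteristics\<close>

context regular_transport
begin

text \<open>Along the direction (1, v) the linear Taylor part is the transport equation and cancels,
  leaving a quadratic error. The sign of s - t is free, so one estimate serves backward and forward
  steps.\<close>

lemma characteristic_step:
  assumes "s \<in> {0..T}" "t \<in> {0..T}"
  shows "\<bar>f s (x + (s - t) *\<^sub>R v t x) - f t x\<bar> \<le> L * (1 + L)\<^sup>2 * (s - t)\<^sup>2"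
proof -
  let ?y = "x + (s - t) *\<^sub>R v t x"
  have "(s - t) * ft t x + fx t x \<bullet> (?y - x) = (s - t) * (ft t x + v t x \<bullet> fx t x)"
    by (simp add: inner_commute algebra_simps)
  then have "f s ?y - f t x = f s ?y - f t x - (s - t) * ft t x - fx t x \<bullet> (?y - x)"
    using transport[OF assms(2), of x] by simp
  also have "\<bar>\<dots>\<bar> \<le> L * (\<bar>s - t\<bar> + norm (?y - x))\<^sup>2"
    using assms by (intro taylor)
  also have "\<dots> \<le> L * ((1 + L) * \<bar>s - t\<bar>)\<^sup>2"
  proof -
    have "norm (?y - x) \<le> L * \<bar>s - t\<bar>"
      using mult_left_mono[OF v_bound[OF assms(2), of x] abs_ge_zero[of "s - t"]] by (simp add: mult.commute)
    then show ?thesis using L_ge_1 by (intro mult_left_mono power_mono) (auto simp: algebra_simps)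
  qed
  finally show ?thesis by (simp add: power_mult_distrib mult.assoc)
qed

text \<open>An Euler polygon runs from \<open>(t, y)\<close> back to time \<open>0\<close>, where a nearby point of the level set
  is available, and a second one starts at that point and runs forward to time \<open>t\<close>. Since \<open>f\<close> is
  only approximately constant along the polygons, the point that is reached lies close to the
  level set at time \<open>t\<close>, but not necessarily on it.\<close>

lemma approximate_level_point:
  assumes initial: "\<And>y. \<bar>f 0 y - 1\<bar> \<le> 2 * \<epsilon> \<Longrightarrow> \<exists>p. f 0 p = 1 \<and> norm (p - y) \<le> K * (2 * \<epsilon>)"
    and t: "t \<in> {0..T}" and y: "\<bar>f t y - 1\<bar> \<le> \<epsilon>"
    and m: "0 < m" and fine: "L * (1 + L)\<^sup>2 * T\<^sup>2 / real m \<le> \<epsilon>"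
  shows "\<exists>p. \<bar>f t p - 1\<bar> \<le> L * (1 + L)\<^sup>2 * T\<^sup>2 / real m \<and> norm (p - y) \<le> exp (L * T) * (2 * K + 1) * \<epsilon>"
proof -
  define \<delta> where "\<delta> = t / real m"
  define A where "A = L * (1 + L)\<^sup>2"
  have \<delta>: "0 \<le> \<delta>" and m\<delta>: "real m * \<delta> = t" using t m by (auto simp: \<delta>_def)
  have A: "0 \<le> A" "L * (1 + L) \<le> A"
    using L_ge_1 by (auto simp: A_def power2_eq_square)
  have time: "real k * \<delta> \<in> {0..T}" if "k \<le> m" for k
  proof -
    have "real k * \<delta> \<le> real m * \<delta>" using that \<delta> by (intro mult_right_mono) auto
    then show ?thesis using \<delta> m\<delta> t by auto
  qed
  have m\<delta>2: "real m * \<delta>\<^sup>2 \<le> T\<^sup>2 / real m"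
  proof -
    have "real m * \<delta>\<^sup>2 = t\<^sup>2 / real m" using m by (simp add: \<delta>_def power2_eq_square)
    also have "\<dots> \<le> T\<^sup>2 / real m" using t by (intro divide_right_mono power_mono) auto
    finally show ?thesis .
  qed
  have total: "A * (real m * \<delta>\<^sup>2) \<le> A * T\<^sup>2 / real m"
    using mult_left_mono[OF m\<delta>2 A(1)] by simp

  define b where "b = rec_nat y (\<lambda>k z. z - \<delta> *\<^sub>R v (real (m - k) * \<delta>) z)"
  have b0: "b 0 = y" and bSuc: "b (Suc k) = b k - \<delta> *\<^sub>R v (real (m - k) * \<delta>) (b k)" for k
    by (auto simp: b_def)
  \<comment> \<open>Reindexing by time: \<open>z k\<close> is the position at time
    \<open>real k * \<delta>\<close>, so that it can be compared with the forward polygon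
    \<open>p k\<close>.\<close>
  define z where "z k = b (m - k)" for k
  have zm: "z m = y" by (simp add: z_def b0)
  have z_step: "z k = z (Suc k) - \<delta> *\<^sub>R v (real (Suc k) * \<delta>) (z (Suc k))" if "k < m" for k
  proof -
    have "m - k = Suc (m - Suc k)" "m - (m - Suc k) = Suc k" using that by auto
    then show ?thesis unfolding z_def by (simp add: bSuc)
  qed
  have f_back: "\<bar>f (real (m - k) * \<delta>) (z (m - k)) - f t y\<bar> \<le> real k * (A * \<delta>\<^sup>2)" if "k \<le> m" for k
    using that
  proof (induction k)
    case 0
    then show ?case by (simp add: m\<delta> zm)
  next
    case (Suc k)
    let ?j = "m - Suc k"
    have j: "m - k = Suc ?j" "?j < m" using Suc by auto
    have "\<bar>f (real ?j * \<delta>) (z (Suc ?j) + (real ?j * \<delta> - real (Suc ?j) * \<delta>) *\<^sub>R v (real (Suc ?j) * \<delta>) (z (Suc ?j)))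
        - f (real (Suc ?j) * \<delta>) (z (Suc ?j))\<bar> \<le> A * (real ?j * \<delta> - real (Suc ?j) * \<delta>)\<^sup>2"
      unfolding A_def using j by (intro characteristic_step time) auto
    moreover have "real ?j * \<delta> - real (Suc ?j) * \<delta> = - \<delta>" by (simp add: algebra_simps)
    ultimately have "\<bar>f (real ?j * \<delta>) (z ?j) - f (real (Suc ?j) * \<delta>) (z (Suc ?j))\<bar> \<le> A * \<delta>\<^sup>2"
      using z_step[OF j(2)] by simp
    then show ?case using Suc.IH Suc.prems unfolding j(1) by (simp add: algebra_simps)
  qed
  have "\<bar>f 0 (z 0) - f t y\<bar> \<le> A * T\<^sup>2 / real m"
    using f_back[of m] total by (simp add: mult_ac)
  \<comment> \<open>One \<epsilon> is the deviation at y, the other the drift along the backward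
    polygon; this is why the initial estimate is assumed for 2\<epsilon>.\<close>
  then have "\<bar>f 0 (z 0) - 1\<bar> \<le> 2 * \<epsilon>" using y fine unfolding A_def by linarith
  from initial[OF this] obtain p0 where p0: "f 0 p0 = 1" "norm (p0 - z 0) \<le> K * (2 * \<epsilon>)" by blast

  define p where "p = rec_nat p0 (\<lambda>k x. x + \<delta> *\<^sub>R v (real k * \<delta>) x)"
  have p0': "p 0 = p0" and pSuc: "p (Suc k) = p k + \<delta> *\<^sub>R v (real k * \<delta>) (p k)" for k
    by (auto simp: p_def)
  have f_forth: "\<bar>f (real k * \<delta>) (p k) - 1\<bar> \<le> real k * (A * \<delta>\<^sup>2)" if "k \<le> m" for k
    using that
  proof (induction k)
    case 0
    then show ?case by (simp add: p0' p0)
  next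
    case (Suc k)
    have "\<bar>f (real (Suc k) * \<delta>) (p k + (real (Suc k) * \<delta> - real k * \<delta>) *\<^sub>R v (real k * \<delta>) (p k))
        - f (real k * \<delta>) (p k)\<bar> \<le> A * (real (Suc k) * \<delta> - real k * \<delta>)\<^sup>2"
      unfolding A_def using Suc by (intro characteristic_step time) auto
    moreover have "real (Suc k) * \<delta> - real k * \<delta> = \<delta>" by (simp add: algebra_simps)
    ultimately have "\<bar>f (real (Suc k) * \<delta>) (p (Suc k)) - f (real k * \<delta>) (p k)\<bar> \<le> A * \<delta>\<^sup>2"
      by (simp add: pSuc)
    moreover have "\<bar>f (real k * \<delta>) (p k) - 1\<bar> \<le> real k * (A * \<delta>\<^sup>2)" using Suc by simp
    moreover have "real (Suc k) * (A * \<delta>\<^sup>2) = real k * (A * \<delta>\<^sup>2) + A * \<delta>\<^sup>2" by (simp add: algebra_simps)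
    ultimately show ?case by linarith
  qed
  let ?q = "1 + \<delta> * L"
  have q: "1 \<le> ?q" using \<delta> L_ge_1 by simp
  \<comment> \<open>A discrete Gronwall estimate. The two polygons evaluate the velocity at opposite
    ends of each time step, which costs a source of order \<open>\<delta>\<^sup>2\<close>. Enlarging
    that source by \<open>?q ^ Suc k\<close>, which is at least 1, keeps the bound in product
    form.\<close>
  have growth: "norm (p k - z k) \<le> ?q ^ k * (K * (2 * \<epsilon>) + real k * (A * \<delta>\<^sup>2))" if "k \<le> m" for k
    using that
  proof (induction k)
    case 0
    then show ?case using p0 by (simp add: p0')
  next
    case (Suc k)
    let ?V = "v (real k * \<delta>) (p k)" and ?W = "v (real (Suc k) * \<delta>) (z (Suc k))"
    let ?E = "K * (2 * \<epsilon>) + real k * (A * \<delta>\<^sup>2)"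
    have k: "k < m" using Suc by simp
    have zz: "norm (z k - z (Suc k)) \<le> \<delta> * L"
      using z_step[OF k] v_bound[OF time[of "Suc k"], of "z (Suc k)"] k \<delta> by (simp add: mult_left_mono)
    have "norm (?V - ?W) \<le> L * (\<bar>real k * \<delta> - real (Suc k) * \<delta>\<bar> + norm (p k - z (Suc k)))"
      using k by (intro v_lipschitz time) auto
    also have "\<bar>real k * \<delta> - real (Suc k) * \<delta>\<bar> = \<delta>" using \<delta> by (simp add: algebra_simps)
    also have "L * (\<delta> + norm (p k - z (Suc k))) \<le> L * (\<delta> + (norm (p k - z k) + \<delta> * L))"
      using norm_triangle_ineq[of "p k - z k" "z k - z (Suc k)"] zz L_ge_1 by (intro mult_left_mono) auto
    finally have VW: "\<delta> * norm (?V - ?W) \<le> \<delta> * (L * (\<delta> + (norm (p k - z k) + \<delta> * L)))"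
      using \<delta> by (intro mult_left_mono)
    have "p (Suc k) - z (Suc k) = (p k - z k) + \<delta> *\<^sub>R (?V - ?W)"
      using z_step[OF k] by (simp add: pSuc algebra_simps)
    then have "norm (p (Suc k) - z (Suc k)) \<le> norm (p k - z k) + \<delta> * norm (?V - ?W)"
      using norm_triangle_ineq[of "p k - z k" "\<delta> *\<^sub>R (?V - ?W)"] \<delta> by simp
    also have "\<dots> \<le> norm (p k - z k) + \<delta> * (L * (\<delta> + (norm (p k - z k) + \<delta> * L)))"
      using VW by simp
    also have "\<dots> = ?q * norm (p k - z k) + L * (1 + L) * \<delta>\<^sup>2"
      by (simp add: power2_eq_square algebra_simps)
    also have "\<dots> \<le> ?q * (?q ^ k * ?E) + ?q ^ Suc k * (A * \<delta>\<^sup>2)"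
    proof (rule add_mono)
      show "?q * norm (p k - z k) \<le> ?q * (?q ^ k * ?E)"
        using Suc q by (intro mult_left_mono) auto
      have "L * (1 + L) * \<delta>\<^sup>2 \<le> A * \<delta>\<^sup>2" using A by (intro mult_right_mono) auto
      also have "\<dots> \<le> ?q ^ Suc k * (A * \<delta>\<^sup>2)"
        using mult_right_mono[OF one_le_power[OF q, of "Suc k"], of "A * \<delta>\<^sup>2"] A by simp
      finally show "L * (1 + L) * \<delta>\<^sup>2 \<le> ?q ^ Suc k * (A * \<delta>\<^sup>2)" .
    qed
    also have "\<dots> = ?q ^ Suc k * (K * (2 * \<epsilon>) + real (Suc k) * (A * \<delta>\<^sup>2))"
      by (simp add: algebra_simps)
    finally show ?case .
  qed
  have "norm (p m - y) \<le> ?q ^ m * (K * (2 * \<epsilon>) + A * (real m * \<delta>\<^sup>2))"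
    using growth[of m] zm by (simp add: mult_ac)
  also have "\<dots> \<le> exp (L * T) * ((2 * K + 1) * \<epsilon>)"
  proof (rule mult_mono)
    have "?q ^ m \<le> exp (\<delta> * L) ^ m" using q by (intro power_mono exp_ge_add_one_self) auto
    also have "\<dots> = exp (L * (real m * \<delta>))" by (simp add: exp_of_nat_mult[symmetric] mult_ac)
    also have "\<dots> \<le> exp (L * T)" using t L_ge_1 by (simp add: m\<delta>)
    finally show "?q ^ m \<le> exp (L * T)" .
    have "A * (real m * \<delta>\<^sup>2) \<le> \<epsilon>" using total fine by (simp add: A_def)
    then show "K * (2 * \<epsilon>) + A * (real m * \<delta>\<^sup>2) \<le> (2 * K + 1) * \<epsilon>" by (simp add: algebra_simps)
    \<comment> \<open>No sign of K is assumed; the quantity is nonnegative because it bounds a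
      norm.\<close>
    have "0 \<le> K * (2 * \<epsilon>)" using p0(2) norm_ge_zero order_trans by blast
    then show "0 \<le> K * (2 * \<epsilon>) + A * (real m * \<delta>\<^sup>2)" using A by simp
  qed simp
  finally have "norm (p m - y) \<le> exp (L * T) * (2 * K + 1) * \<epsilon>" by (simp add: mult.assoc)
  moreover have "\<bar>f t (p m) - 1\<bar> \<le> A * T\<^sup>2 / real m"
    using f_forth[of m] total m\<delta> by (simp add: mult_ac)
  ultimately show ?thesis unfolding A_def by blast
qed

text \<open>The radius in the preceding estimate does not depend on the number of Euler steps. So
  one fixed compact ball contains points with values of \<open>f t\<close> arbitrarily close to 1,
  and a minimizer of the deviation on it lies exactly on the level set.\<close>

lemma level_point_nearby:
  assumes initial: "\<And>y. \<bar>f 0 y - 1\<bar> \<le> 2 * \<epsilon> \<Longrightarrow> \<exists>p. f 0 p = 1 \<and> norm (p - y) \<le> K * (2 * \<epsilon>)"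
    and \<epsilon>: "0 < \<epsilon>" and t: "t \<in> {0..T}" and y: "\<bar>f t y - 1\<bar> \<le> \<epsilon>"
  shows "\<exists>p. f t p = 1 \<and> norm (p - y) \<le> exp (L * T) * (2 * K + 1) * \<epsilon>"
proof -
  let ?a = "L * (1 + L)\<^sup>2 * T\<^sup>2" and ?R = "exp (L * T) * (2 * K + 1) * \<epsilon>"
  have small: "\<forall>\<^sub>F m in sequentially. ?a / real m \<le> e" if "0 < e" for e
  proof -
    have "(\<lambda>m. ?a / real m) \<longlonglongrightarrow> 0"
      by (rule tendsto_divide_0[OF tendsto_const filterlim_real_at_infinity_sequentially])
    then have "\<forall>\<^sub>F m in sequentially. ?a / real m < e" using that by (rule order_tendstoD)
    then show ?thesis by eventually_elim simp
  qed
  have approx: "\<exists>p\<in>cball y ?R. \<bar>f t p - 1\<bar> \<le> e" if e: "0 < e" for e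
  proof -
    have "\<forall>\<^sub>F m in sequentially. ?a / real m \<le> \<epsilon> \<and> ?a / real m \<le> e \<and> 0 < m"
      using small[OF \<epsilon>] small[OF e] eventually_gt_at_top[of 0] by eventually_elim simp
    then obtain m where m: "?a / real m \<le> \<epsilon>" "?a / real m \<le> e" "0 < m"
      using eventually_happens'[OF sequentially_bot] by blast
    from approximate_level_point[OF initial t y m(3,1)] m(2) show ?thesis
      by (auto simp: dist_norm norm_minus_commute intro: order_trans)
  qed
  have "cball y ?R \<noteq> {}" using approx[of 1] by auto
  moreover have "continuous_on (cball y ?R) (\<lambda>p. \<bar>f t p - 1\<bar>)"
    by (intro continuous_intros f_continuous t)
  ultimately obtain p where p: "p \<in> cball y ?R" "\<And>p'. p' \<in> cball y ?R \<Longrightarrow> \<bar>f t p - 1\<bar> \<le> \<bar>f t p' - 1\<bar>"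
    using continuous_attains_inf[OF compact_cball] by metis
  have "\<bar>f t p - 1\<bar> \<le> e" if "0 < e" for e
    using approx[OF that] p(2) by force
  then have "f t p = 1" using field_le_epsilon[of "\<bar>f t p - 1\<bar>" 0] by simp
  with p(1) show ?thesis by (auto simp: dist_norm norm_minus_commute)
qed

text \<open>A point of the discrete level set has grid neighbours on both sides of the level \<open>1\<close>; the
  neighbour outside is an inner grid point because \<open>f\<close> vanishes off \<open>\<Omega>\<close>.\<close>

lemma discrete_level_set_value:
  assumes h: "0 < h" and t: "t \<in> {0..T}"
    and outside: "\<And>x. x \<notin> \<Omega> \<Longrightarrow> f t x = 0"
    and error: "\<And>x. x \<in> grid h \<Longrightarrow> \<bar>\<phi> x - f t x\<bar> \<le> E"
    and small: "E + 5 * L * h < 1"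
    and y: "y \<in> discrete_level_set h \<Omega> \<phi>"
  shows "\<bar>f t y - 1\<bar> \<le> E + L * h"
proof -
  let ?A = "{x + h *\<^sub>R \<omega> | x \<omega>. x \<in> inner_grid h \<Omega> \<and> \<phi> x > 1 \<and> \<omega> \<in> stencil}"
  from y obtain x \<omega> where x: "y = x + h *\<^sub>R \<omega>" "x \<in> inner_grid h \<Omega>" "\<phi> x > 1" "\<omega> \<in> stencil"
    and bdry: "\<not> (\<Union>i\<in>UNIV. {y + h *\<^sub>R axis i 1, y - h *\<^sub>R axis i 1}) \<subseteq> ?A"
    unfolding discrete_level_set_def discrete_boundary_def by blast
  from bdry obtain \<omega>' where \<omega>': "\<omega>' \<in> stencil" and out: "y + h *\<^sub>R \<omega>' \<notin> ?A"
    using axis_in_stencil by fastforce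
  define z where "z = y + h *\<^sub>R \<omega>'"
  have stencil_norm: "norm \<eta> \<le> 1" if "\<eta> \<in> stencil" for \<eta>
    using that by (auto simp: stencil_def)
  have xg: "x \<in> grid h" using x(2) by (simp add: inner_grid_def)
  have yg: "y \<in> grid h" unfolding x(1) using xg x(4) by (rule grid_shift)
  have zg: "z \<in> grid h" unfolding z_def using yg \<omega>' by (rule grid_shift)
  have yx: "norm (y - x) \<le> h" using stencil_norm[OF x(4)] h by (simp add: x(1))
  have zy: "norm (z - y) \<le> h" using stencil_norm[OF \<omega>'] h by (simp add: z_def)
  have fx_gt: "1 - E < f t x" using error[OF xg] x(3) by linarith
  have "cell (2 * h) z \<subseteq> \<Omega>"
  proof
    fix w assume w: "w \<in> cell (2 * h) z"
    have "\<bar>(w - z) $ i\<bar> \<le> h" for i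
    proof -
      have "z $ i - 2 * h / 2 \<le> w $ i \<and> w $ i < z $ i + 2 * h / 2" using w by (simp add: cell_def)
      then show ?thesis unfolding vector_minus_component by linarith
    qed
    then have "norm (w - z) \<le> (\<Sum>i\<in>(UNIV :: 3 set). h)"
      by (intro order_trans[OF norm_le_l1_cart] sum_mono)
    then have wz: "norm (w - z) \<le> 3 * h" by simp
    show "w \<in> \<Omega>"
    proof (rule ccontr)
      assume "w \<notin> \<Omega>"
      then have "f t x \<le> L * norm (w - x)" using f_lipschitz[OF t, of w x] outside[of w] by auto
      also have "norm (w - x) \<le> norm (w - z) + norm (z - y) + norm (y - x)"
        using norm_triangle_ineq[of "w - z" "z - x"] norm_triangle_ineq[of "z - y" "y - x"] by simp
      also have "\<dots> \<le> 5 * h" using wz zy yx by simp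
      \<comment> \<open>The factor 5 is 3 for the l1 bound in the doubled cell plus 1 for each of
        the two grid steps from x to z.\<close>
      finally have "f t x \<le> L * (5 * h)" using L_ge_1 by simp
      then show False using fx_gt small by simp
    qed
  qed
  moreover have "z \<in> cell (2 * h) z" using h by (simp add: cell_def)
  ultimately have "z \<in> inner_grid h \<Omega>" using zg by (auto simp: inner_grid_def)
  \<comment> \<open>Otherwise z itself, taken with the stencil vector 0, would belong to the set
    that it was chosen to avoid.\<close>
  then have "\<not> \<phi> z > 1"
    using out axis_in_stencil(3) unfolding z_def by force
  then have "f t z \<le> 1 + E" using error[OF zg] by linarith
  moreover have "\<bar>f t y - f t x\<bar> \<le> L * h"
    using f_lipschitz[OF t, of y x] mult_left_mono[OF yx, of L] L_ge_1 by linarith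
  moreover have "\<bar>f t z - f t y\<bar> \<le> L * h"
    using f_lipschitz[OF t, of z y] mult_left_mono[OF zy, of L] L_ge_1 by linarith
  ultimately show ?thesis using fx_gt by linarith
qed

end

theorem theorem5p1:
  fixes T \<alpha> c C :: real
    and \<Omega> \<Omega>p :: "(real^3) set"
    and v :: "real \<Rightarrow> real^3 \<Rightarrow> real^3"
    and f0 :: "real^3 \<Rightarrow> real"
    and f :: "real \<Rightarrow> real^3 \<Rightarrow> real"
  assumes "T > 0"
    and "bounded \<Omega>" and "connected \<Omega>" and "open \<Omega>"
    and "C_closure 4 ({0<..<T} \<times> \<Omega>) (\<lambda>(t, x). v t x)"
    and "\<And>t x. t \<in> {0..T} \<Longrightarrow> x \<in> \<Omega> \<Longrightarrow> divergence (v t) x = 0"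
    and "closure {(t, x). t \<in> {0..T} \<and> x \<in> closure \<Omega> \<and> v t x \<noteq> 0} \<subseteq> {0..T} \<times> \<Omega>"
    and "\<And>t x. t \<in> {0..T} \<Longrightarrow> x \<notin> \<Omega> \<Longrightarrow> v t x = 0"
    and "C_closure 4 \<Omega> f0"
    and "\<exists>U. open U \<and> frontier \<Omega> \<subseteq> U \<and> (\<forall>x\<in>U \<inter> closure \<Omega>. f0 x = 0)"
    and "\<And>x. x \<notin> \<Omega> \<Longrightarrow> f0 x = 0"
    and "connected \<Omega>p" and "open \<Omega>p" and "closure \<Omega>p \<subseteq> \<Omega>"
    and "\<And>x. x \<in> \<Omega>p \<Longrightarrow> f0 x > 1"
    and "\<And>x. x \<in> \<Omega> - closure \<Omega>p \<Longrightarrow> f0 x < 1"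
    and "\<And>x. x \<in> frontier \<Omega>p \<Longrightarrow> gradient f0 x \<noteq> 0"
    and "transport_solution T v f0 f"
    and "0 < \<alpha>" and "\<alpha> \<le> 1"
    and "0 < c" and "c \<le> C"
  shows "\<exists>M9>0. \<exists>\<delta>>0. \<forall>h \<tau> N g.
      0 < h \<and> h < \<delta> \<and> 0 < \<tau> \<and> \<tau> < \<delta> \<and>
      c * h powr (2 - \<alpha>) \<le> \<tau> \<and> \<tau> \<le> C * h powr (2 - \<alpha>) \<and>
      T \<in> {\<tau> * real N..<\<tau> * real N + \<tau>} \<and>
      CFL_condition h \<tau> N v \<and>
      explicit_scheme h \<tau> N v f0 g \<longrightarrow>
      (MAX n\<in>{0..N}. one_sided_dist (discrete_level_set h \<Omega> (g n)) (level_set \<Omega> f (real n * \<tau>)))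
        \<le> ennreal (M9 * h powr \<alpha>)"
proof -
  have smooth_v: "C_closure (Suc 3) ({0<..<T} \<times> \<Omega>) (\<lambda>(t, x). v t x)"
    using assms(5) by simp
  have f0: "f 0 = f0" using assms(18) by (auto simp: transport_solution_def)
  obtain L1 where L1: "L1 \<ge> 0"
    "\<And>s t x y. s \<in> {0..T} \<Longrightarrow> t \<in> {0..T} \<Longrightarrow> norm (v t y - v s x) \<le> L1 * (\<bar>t - s\<bar> + norm (y - x))"
    "\<And>t x. t \<in> {0..T} \<Longrightarrow> norm (v t x) \<le> L1"
    by (rule velocity_lipschitz[OF assms(1,2,4) smooth_v assms(7,8)]) blast+
  obtain ft L2 where L2: "L2 \<ge> 0"
    and taylor: "\<And>s t x y. s \<in> {0..T} \<Longrightarrow> t \<in> {0..T} \<Longrightarrow>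
      \<bar>f t y - f s x - (t - s) * ft s x - gradient (f s) x \<bullet> (y - x)\<bar> \<le> L2 * (\<bar>t - s\<bar> + norm (y - x))\<^sup>2"
    and pde: "\<And>s x. s \<in> {0..T} \<Longrightarrow> ft s x + v s x \<bullet> gradient (f s) x = 0"
    and f_lip: "\<And>t x y. t \<in> {0..T} \<Longrightarrow> \<bar>f t y - f t x\<bar> \<le> L2 * norm (y - x)"
    and outside: "\<And>t x. t \<in> {0..T} \<Longrightarrow> x \<notin> \<Omega> \<Longrightarrow> f t x = 0"
    and grad_cont: "\<And>t. t \<in> {0..T} \<Longrightarrow> continuous_on UNIV (gradient (f t))"
    by (rule transport_solution_regularity[OF assms(1,2,18,8,11)]) blast+
  define L where "L = 1 + L1 + L2"
  have L: "1 \<le> L" "L1 \<le> L" "L2 \<le> L" using L1(1) L2 by (auto simp: L_def)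
  interpret regular_transport T L v f ft "\<lambda>t. gradient (f t)"
  proof
    fix s t x y assume st: "s \<in> {0..T}" "t \<in> {0..T}"
    show "norm (v t y - v s x) \<le> L * (\<bar>t - s\<bar> + norm (y - x))"
      using L1(2)[OF st, of y x] mult_right_mono[OF L(2), of "\<bar>t - s\<bar> + norm (y - x)"] by simp
    show "\<bar>f t y - f s x - (t - s) * ft s x - gradient (f s) x \<bullet> (y - x)\<bar> \<le> L * (\<bar>t - s\<bar> + norm (y - x))\<^sup>2"
      using taylor[OF st, of y x] mult_right_mono[OF L(3), of "(\<bar>t - s\<bar> + norm (y - x))\<^sup>2"] by simp
  next
    fix t x y assume t: "t \<in> {0..T}"
    show "norm (v t x) \<le> L" using L1(3)[OF t, of x] L(2) by simp
    show "\<bar>f t y - f t x\<bar> \<le> L * norm (y - x)"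
      using f_lip[OF t, of y x] mult_right_mono[OF L(3), of "norm (y - x)"] by simp
  qed (use assms(1) L(1) pde in auto)

  have zero: "0 \<in> {0..T}" using assms(1) by simp
  obtain K \<epsilon>0 where K: "0 < K" "0 < \<epsilon>0"
    "\<And>y \<epsilon>. 0 < \<epsilon> \<Longrightarrow> \<epsilon> \<le> \<epsilon>0 \<Longrightarrow> \<bar>f 0 y - 1\<bar> \<le> \<epsilon> \<Longrightarrow> \<exists>p. f 0 p = 1 \<and> norm (p - y) \<le> K * \<epsilon>"
  proof (rule level_set_metric_regularity[of "closure \<Omega>" "f 0" "gradient (f 0)" L])
    show "compact (closure \<Omega>)" using assms(2) by simp
    show "f 0 x = 0" if "x \<notin> closure \<Omega>" for x
      using that outside[OF zero] closure_subset by blast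
    show "continuous_on UNIV (f 0)" using f_continuous[OF zero] .
    show "\<bar>f 0 y - f 0 x - gradient (f 0) x \<bullet> (y - x)\<bar> \<le> L * (norm (y - x))\<^sup>2" for x y
      using taylor[OF zero zero, of y x] mult_right_mono[OF L(3), of "(norm (y - x))\<^sup>2"] by simp
    show "gradient (f 0) x \<noteq> 0" if "f 0 x = 1" for x
    proof -
      \<comment> \<open>A point of level 1 is excluded from \<open>\<Omega>p\<close> by f0 > 1 there
        and from the complement of its closure by f0 < 1, so it is a frontier point.\<close>
      have "x \<in> \<Omega>" using that outside[OF zero, of x] by auto
      then have "x \<in> closure \<Omega>p" using that assms(16)[of x] f0 by force
      moreover have "x \<notin> \<Omega>p" using that assms(15)[of x] f0 by force
      ultimately have "x \<in> frontier \<Omega>p" using assms(13) by (simp add: frontier_def interior_open)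
      then show ?thesis using assms(17) f0 by simp
    qed
  qed (use grad_cont[OF zero] L(1) in auto)

  define M where "M = 2 * L + 10 * L\<^sup>2 * T * (C + 1 / c + 1)"
  \<comment> \<open>Q covers both the deviation bound with M + L and the smallness condition with M
    + 5L.\<close>
  define Q where "Q = M + 5 * L"
  \<comment> \<open>The bound 1 meets that smallness condition, and half of \<epsilon>0 keeps
    \<open>2 * Q * h powr \<alpha>\<close> within the range of the estimate at time 0. The choice of
    \<delta> solves \<open>Q * h powr \<alpha> < \<eta>\<close> for h.\<close>
  define \<eta> where "\<eta> = min 1 (\<epsilon>0 / 2)"
  define \<delta> where "\<delta> = min 1 ((\<eta> / Q) powr (1 / \<alpha>))"
  define M9 where "M9 = exp (L * T) * (2 * K + 1) * Q"
  have M: "0 < M" using L(1) assms(1,21,22) unfolding M_def by (intro add_pos_nonneg) auto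
  have Q: "0 < Q" using M L(1) by (simp add: Q_def)
  have \<eta>: "0 < \<eta>" "\<eta> \<le> 1" "2 * \<eta> \<le> \<epsilon>0" using K(2) by (auto simp: \<eta>_def)
  have "0 < M9" using K(1) Q by (simp add: M9_def)
  moreover have "0 < \<delta>" using \<eta> Q by (simp add: \<delta>_def)
  moreover have "(MAX n\<in>{0..N}. one_sided_dist (discrete_level_set h \<Omega> (g n)) (level_set \<Omega> f (real n * \<tau>)))
      \<le> ennreal (M9 * h powr \<alpha>)"
    if h: "0 < h" "h < \<delta>" and \<tau>: "0 < \<tau>"
      and scale: "c * h powr (2 - \<alpha>) \<le> \<tau>" "\<tau> \<le> C * h powr (2 - \<alpha>)"
      and N: "T \<in> {\<tau> * real N..<\<tau> * real N + \<tau>}"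
      and cfl: "CFL_condition h \<tau> N v" and scheme: "explicit_scheme h \<tau> N v f0 g"
    for h \<tau> N g
  proof (rule Max.boundedI)
    fix a assume "a \<in> (\<lambda>n. one_sided_dist (discrete_level_set h \<Omega> (g n)) (level_set \<Omega> f (real n * \<tau>))) ` {0..N}"
    then obtain n where n: "n \<le> N"
      and a: "a = one_sided_dist (discrete_level_set h \<Omega> (g n)) (level_set \<Omega> f (\<tau> * real n))"
      by (auto simp: mult.commute)
    have h1: "h \<le> 1" using h by (simp add: \<delta>_def)
    have hh: "h \<le> h powr \<alpha>" using powr_mono'[of \<alpha> 1 h] h(1) h1 assms(19,20) by simp
    have NT: "\<tau> * real N \<le> T" using N by simp
    have "\<tau> * real n \<le> \<tau> * real N" using n \<tau> by (intro mult_left_mono) auto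
    then have "\<tau> * real n \<le> T" using NT by linarith
    then have t: "\<tau> * real n \<in> {0..T}" using \<tau> by simp
    have "h powr \<alpha> < ((\<eta> / Q) powr (1 / \<alpha>)) powr \<alpha>"
      using h assms(19) by (intro powr_less_mono2) (auto simp: \<delta>_def)
    then have small: "Q * h powr \<alpha> < \<eta>"
      using assms(19) \<eta> Q by (simp add: powr_powr pos_less_divide_eq mult.commute)
    have Lh: "L * h \<le> L * h powr \<alpha>" using hh L(1) by simp
    have error: "\<bar>g n x - f (\<tau> * real n) x\<bar> \<le> M * h powr \<alpha>" if "x \<in> grid h" for x
      unfolding M_def
      using scheme_convergence[OF h(1) h1 \<tau> NT assms(19,20,21) _ scale cfl _ n that] scheme f0 assms(21,22)
      by simp
    show "a \<le> ennreal (M9 * h powr \<alpha>)"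
      unfolding a one_sided_dist_def
    proof (rule SUP_least)
      fix y assume y: "y \<in> discrete_level_set h \<Omega> (g n)"
      let ?\<epsilon> = "Q * h powr \<alpha>"
      have "\<bar>f (\<tau> * real n) y - 1\<bar> \<le> M * h powr \<alpha> + L * h"
      proof (rule discrete_level_set_value[OF h(1) t outside[OF t] error _ y])
        show "M * h powr \<alpha> + 5 * L * h < 1"
          using Lh small \<eta>(2) by (simp add: Q_def algebra_simps)
      qed
      also have "\<dots> \<le> ?\<epsilon>"
        using Lh L(1) h(1) by (simp add: Q_def algebra_simps)
      finally have fy: "\<bar>f (\<tau> * real n) y - 1\<bar> \<le> ?\<epsilon>" .
      have \<epsilon>: "0 < ?\<epsilon>" using Q h(1) by simp
      have "\<exists>p. f 0 p = 1 \<and> norm (p - z) \<le> K * (2 * ?\<epsilon>)" if "\<bar>f 0 z - 1\<bar> \<le> 2 * ?\<epsilon>" for z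
        by (rule K(3)) (use that small \<eta>(3) \<epsilon> in auto)
      from level_point_nearby[OF this \<epsilon> t fy] obtain p where
        p: "f (\<tau> * real n) p = 1" "norm (p - y) \<le> M9 * h powr \<alpha>"
        by (auto simp: M9_def mult.assoc)
      have "p \<in> \<Omega>" using p(1) outside[OF t, of p] by auto
      then have "p \<in> level_set \<Omega> f (\<tau> * real n)" using p(1) by (simp add: level_set_def)
      then show "(INF x\<in>level_set \<Omega> f (\<tau> * real n). ennreal (dist y x)) \<le> ennreal (M9 * h powr \<alpha>)"
        using p(2) by (intro INF_lower2) (auto simp: dist_norm norm_minus_commute intro: ennreal_leI)
    qed
  qed auto
  ultimately show ?thesis by blast
qed

end
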